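(* Let $H$ be a complex Hilbert space and let $T\in\mathcal{B}(H)$ be a Ritt operator. Let $\gamma:[-\delta_-,\delta_+]\to\mathbb{C}$ be a v-type curve and set $r(\theta)=|\gamma(\theta)|$. Assume there exist $\nu\ge r(\delta_+)-1$ and a continuous increasing function $\varepsilon:(0,\nu]\to(0,\infty)$ with $\varepsilon(0^+)=0$ such that $$\|(\lambda-T)^{-1}\|\le\frac{1+\varepsilon(|\lambda|-1)}{|\lambda|-1}$$ for all $\lambda\neq 1$ in the set determined by $\gamma$. If $$\int_{-\delta_-}^{\delta_+}\frac{\varepsilon(r(\theta)-1)}{|\theta|^2\,(r(\theta)-1)}\,d\theta<\infty,$$ then $T$ is similar to a contraction.
   Context: $\varepsilon(0^+)=\lim_{x\to0^+}\varepsilon(x)$. $T$ is a Ritt operator if $\sigma(T)\subset\overline{\mathbb{D}}$ (closed unit disk) and there exists $C>0$ such that $\|(\lambda-T)^{-1}\|\le\frac{C}{|\lambda-1|}$ for all $|\lambda|>1$. v-type curve: let $\delta_-,\delta_+\in(0,\pi)$, let $r:[-\delta_-,\delta_+]\to[1,+\infty)$ be continuous and $\gamma(\theta)=r(\theta)e^{-i\theta}$ for $\theta\in[-\delta_-,\delta_+]$. The curve $\gamma$ is a v-type curve if (a) $r$ strictly increases on $[0,\delta_+]$ and strictly decreases on $[-\delta_-,0]$; (b) $r(0)=1$ and $r(-\delta_-)=r(\delta_+)>1$; (c) $\int_{-\delta_-}^{\delta_+}\frac{1}{r(\theta)-1}\,d\theta<\infty$. The set determined by the v-type curve $\gamma$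 is the closed domain bordered by the Jordan curve that is the union of $\gamma$ and the arc $\{r(\delta_+)e^{-i\theta}:-\delta_-\le\theta\le\delta_+\}$; that is, the set $\{\rho e^{-i\theta}:-\delta_-\le\theta\le\delta_+,\ r(\theta)\le\rho\le r(\delta_+)\}$. $T$ is similar to a contraction if there is a bounded invertible operator $S$ on $H$ with $\|STS^{-1}\|\le1$. *)

theory Defs
  imports "HOL-Analysis.Analysis"
begin

text \<open>
  The library only has real Hilbert spaces (a complete \<^class>\<open>real_inner\<close>). A complex Hilbert
  space is a complete space with a complex scalar multiplication extending the real one and
  a sesquilinear form, linear in its first argument, whose real part is the underlying real inner
  product. Definiteness of the form and \<open>norm x = sqrt (Re (cinner x x))\<close> are thereby inherited
  from \<^class>\<open>real_inner\<close>. Conversely, any complex Hilbert space is an instance, its real inner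
  product being the real part of the complex one.
\<close>

class complex_hilbert_space = real_inner + banach +
  fixes scaleC :: "complex \<Rightarrow> 'a \<Rightarrow> 'a"  (infixr \<open>*\<^sub>C\<close> 75)
    and cinner :: "'a \<Rightarrow> 'a \<Rightarrow> complex"
  assumes scaleC_add_right: "c *\<^sub>C (x + y) = c *\<^sub>C x + c *\<^sub>C y"
    and scaleC_add_left: "(c + d) *\<^sub>C x = c *\<^sub>C x + d *\<^sub>C x"
    and scaleC_scaleC: "c *\<^sub>C (d *\<^sub>C x) = (c * d) *\<^sub>C x"
    and scaleC_of_real: "complex_of_real a *\<^sub>C x = a *\<^sub>R x"
    and cinner_add_left: "cinner (x + y) z = cinner x z + cinner y z"
    and cinner_scaleC_left: "cinner (c *\<^sub>C x) y = c * cinner x y"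
    and cinner_commute: "cinner x y = cnj (cinner y x)"
    and Re_cinner: "Re (cinner x y) = inner x y"

text \<open>
  Bounded complex-linear operators. Their operator norm is \<^const>\<open>onorm\<close>, which does not refer
  to the scalar field.
\<close>

definition bounded_clinear ::
    "('a::complex_hilbert_space \<Rightarrow> 'b::complex_hilbert_space) \<Rightarrow> bool" where
  "bounded_clinear T \<longleftrightarrow> bounded_linear T \<and> (\<forall>c x. T (c *\<^sub>C x) = c *\<^sub>C T x)"

definition spectrum :: "('a::complex_hilbert_space \<Rightarrow> 'a) \<Rightarrow> complex set" where
  "spectrum T = {z. \<not> (\<exists>R. bounded_clinear R \<and>
     (\<forall>x. R (z *\<^sub>C x - T x) = x) \<and> (\<forall>x. z *\<^sub>C R x - T (R x) = x))}"

text \<open>Only meaningful for \<open>z\<close> outside the spectrum, where it is the bounded inverse.\<close>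

definition resolvent :: "('a::complex_hilbert_space \<Rightarrow> 'a) \<Rightarrow> complex \<Rightarrow> 'a \<Rightarrow> 'a" where
  "resolvent T z = inv (\<lambda>x. z *\<^sub>C x - T x)"

definition ritt_operator :: "('a::complex_hilbert_space \<Rightarrow> 'a) \<Rightarrow> bool" where
  "ritt_operator T \<longleftrightarrow> bounded_clinear T \<and> spectrum T \<subseteq> cball 0 1 \<and>
     (\<exists>C>0. \<forall>z. cmod z > 1 \<longrightarrow> onorm (resolvent T z) \<le> C / cmod (z - 1))"

definition similar_to_contraction :: "('a::complex_hilbert_space \<Rightarrow> 'a) \<Rightarrow> bool" where
  "similar_to_contraction T \<longleftrightarrow>
     (\<exists>S S'. bounded_clinear (S :: 'a \<Rightarrow> 'a) \<and> bounded_clinear S' \<and>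
        S \<circ> S' = id \<and> S' \<circ> S = id \<and> onorm (S \<circ> T \<circ> S') \<le> 1)"

text \<open>
  The parameters \<open>dm\<close>, \<open>dp\<close> are $\delta_-$, $\delta_+$. The integrand in the last condition
  has the value \<open>1 / 0 = 0\<close> at \<open>\<theta> = 0\<close>, which is a null set; elsewhere it is positive.
\<close>

definition v_type_curve :: "real \<Rightarrow> real \<Rightarrow> (real \<Rightarrow> complex) \<Rightarrow> bool" where
  "v_type_curve dm dp \<gamma> \<longleftrightarrow>
     dm \<in> {0<..<pi} \<and> dp \<in> {0<..<pi} \<and>
     (\<exists>r. continuous_on {-dm..dp} r \<and> (\<forall>\<theta>\<in>{-dm..dp}. r \<theta> \<ge> 1) \<and>
        (\<forall>\<theta>\<in>{-dm..dp}. \<gamma> \<theta> = complex_of_real (r \<theta>) * cis (-\<theta>)) \<and>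
        strict_mono_on {0..dp} r \<and> strict_antimono_on {-dm..0} r \<and>
        r 0 = 1 \<and> r (-dm) = r dp \<and> r dp > 1 \<and>
        (\<integral>\<^sup>+\<theta>\<in>{-dm..dp}. ennreal (1 / (r \<theta> - 1)) \<partial>lborel) < \<infinity>)"

definition v_type_domain :: "real \<Rightarrow> real \<Rightarrow> (real \<Rightarrow> complex) \<Rightarrow> complex set" where
  "v_type_domain dm dp \<gamma> =
     {complex_of_real \<rho> * cis (-\<theta>) | \<rho> \<theta>.
        \<theta> \<in> {-dm..dp} \<and> cmod (\<gamma> \<theta>) \<le> \<rho> \<and> \<rho> \<le> cmod (\<gamma> dp)}"

end

theory Submission
  imports Defs "HOL-Complex_Analysis.Complex_Analysis"
begin

text \<open>
Write \<open>Q w\<close> for the inverse of \<open>1 - w T\<close>, \<open>\<bar>w\<bar> < 1\<close>. The Ritt condition says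
\<open>\<parallel>Q w\<parallel> \<le> C / \<bar>1 - w\<bar>\<close>. Put \<open>s = r \<theta> - 1\<close>. At the point \<open>\<mu> = r \<theta> e\<^sup>-\<^sup>i\<^sup>\<theta>\<close> of the curve the
hypothesis says that \<open>\<mu> - T\<close> is bounded below almost as if \<open>T\<close> were a contraction. Expanding a square
turns this into a one-sided estimate \<open>Re \<langle>Q (t e\<^sup>i\<^sup>\<theta>) x, x\<rangle> \<ge> - h \<theta> \<parallel>x\<parallel>\<^sup>2\<close>, where \<open>h\<close> is a
combination of \<open>1 / s\<close>, \<open>\<epsilon> s / (\<theta>\<^sup>2 s)\<close> and a constant; the factor \<open>1 / \<theta>\<^sup>2\<close> comes from the Ritt
condition (\<open>inner_Q_ge_near_contractive_point\<close>). When \<open>1 - t\<close> is not small compared to \<open>s\<close>, the Ritt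
condition alone gives such a bound of order \<open>1 / s\<close>. By the two integrability assumptions, \<open>h\<close> is
integrable, and it does not depend on \<open>t\<close>.

So \<open>Re Q + h\<close> is a positive operator-valued density on the circle whose total mass stays bounded as
\<open>t\<close> tends to \<open>1\<close>, and the Fourier coefficients of \<open>Q\<close> are the powers of \<open>t T\<close>. Pairing it with
trigonometric polynomials that carry the factor \<open>b = (1 - e\<^sup>-\<^sup>i\<^sup>\<theta>)\<^sup>1\<^sup>/\<^sup>2\<close>, and using the Cauchy-Schwarz
inequality for the density, gives bounds for the operators
\<open>U\<^sub>k = (t T)\<^sup>k (1 - t T)\<^sup>1\<^sup>/\<^sup>2\<close>: both \<open>\<Sum> \<parallel>U\<^sub>k x\<parallel>\<^sup>2 \<le> K \<parallel>x\<parallel>\<^sup>2\<close> and the dual inequality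
\<open>\<parallel>\<Sum> U\<^sub>k c\<^sub>k\<parallel>\<^sup>2 \<le> K \<Sum> \<parallel>c\<^sub>k\<parallel>\<^sup>2\<close> hold, uniformly in \<open>t\<close> (\<open>square_function_bound\<close>,
\<open>dual_square_function_bound\<close>). The exponent one half is the right one because \<open>\<bar>b\<bar>\<^sup>2\<close>
compensates the growth of \<open>\<parallel>Q\<parallel>\<close> at \<open>\<theta> = 0\<close>.

Since \<open>x - (t T)\<^sup>2\<^sup>n x = \<Sum>\<^sub>k\<^sub><\<^sub>n U\<^sub>k U\<^sub>k (x + t T x)\<close>, the two inequalities show that \<open>T\<close> is power
bounded, which permits \<open>t = 1\<close>; then that \<open>T\<^sup>2\<^sup>n x\<close> converges, to \<open>P x\<close> say, and that
\<open>\<Sum> \<parallel>U\<^sub>k x\<parallel>\<^sup>2 + \<parallel>P x\<parallel>\<^sup>2\<close> is equivalent to \<open>\<parallel>x\<parallel>\<^sup>2\<close>. Applying \<open>T\<close> only drops the first term of the sum,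
so \<open>T\<close> is a contraction for this new Hilbert norm
(\<open>similar_to_contraction_if_Re_bounded_below\<close>). An equivalent Hilbert norm has the form \<open>\<parallel>S x\<parallel>\<close>
with \<open>S\<close> positive and invertible, and this \<open>S\<close> is the required similarity
(\<open>similar_to_contraction_if_form\<close>).
\<close>

section \<open>Complex Hilbert spaces\<close>

lemma scaleC_one [simp]: "1 *\<^sub>C x = x"
  using scaleC_of_real[of 1 x] by simp

lemma scaleC_zero_left [simp]: "0 *\<^sub>C x = 0"
  using scaleC_of_real[of 0 x] by simp

lemma scaleC_scaleR_right: "c *\<^sub>C (a *\<^sub>R x) = a *\<^sub>R (c *\<^sub>C x)"
  by (metis mult.commute scaleC_of_real scaleC_scaleC)

lemma scaleC_of_real_mult: "(complex_of_real a * c) *\<^sub>C x = a *\<^sub>R (c *\<^sub>C x)"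
  by (metis scaleC_of_real scaleC_scaleC)

lemma inner_scaleC_left: "inner (c *\<^sub>C x) y = Re (c * cinner x y)"
  by (metis Re_cinner cinner_scaleC_left)

lemma inner_scaleC_cnj: "inner (c *\<^sub>C x) y = inner x (cnj c *\<^sub>C y)"
proof -
  have "cinner x (cnj c *\<^sub>C y) = c * cinner x y"
    by (metis cinner_commute cinner_scaleC_left complex_cnj_cnj complex_cnj_mult)
  then show ?thesis by (metis inner_scaleC_left Re_cinner)
qed

lemma norm_scaleC [simp]: "norm (c *\<^sub>C x) = cmod c * norm (x::'a::complex_hilbert_space)"
proof -
  have "inner (c *\<^sub>C x) (c *\<^sub>C x) = inner ((cmod c)\<^sup>2 *\<^sub>R x) x"
    by (metis complex_norm_square inner_scaleC_cnj inner_commute scaleC_of_real scaleC_scaleC mult.commute)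
  then have "(norm (c *\<^sub>C x))\<^sup>2 = (cmod c * norm x)\<^sup>2"
    by (simp add: dot_square_norm power_mult_distrib)
  then show ?thesis by (simp add: power2_eq_iff_nonneg)
qed

lemma bounded_linear_scaleC: "bounded_linear (\<lambda>x::'a::complex_hilbert_space. c *\<^sub>C x)"
  by (rule bounded_linear_intro[where K="cmod c"])
     (simp_all add: scaleC_add_right scaleC_scaleR_right)

lemma scaleC_diff_right: "c *\<^sub>C (x - y) = c *\<^sub>C x - c *\<^sub>C (y::'a::complex_hilbert_space)"
  by (rule linear_diff[OF bounded_linear.linear[OF bounded_linear_scaleC]])

text \<open>Only the real part of \<^const>\<open>cinner\<close> is a real inner product, so the Cauchy-Schwarz inequality is
applied after rotating \<open>x\<close> until \<open>cinner x y\<close> becomes real.\<close>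

lemma cmod_cinner_le: "cmod (cinner x y) \<le> norm x * norm (y::'a::complex_hilbert_space)"
proof (cases "cinner x y = 0")
  case False
  define c where "c = cnj (sgn (cinner x y))"
  have "cnj z * z = of_real (cmod z) * of_real (cmod z)" for z
    using complex_norm_square[of z] by (simp add: power2_eq_square mult.commute)
  then have "c * cinner x y = cmod (cinner x y)"
    using False by (simp add: c_def sgn_div_norm scaleR_conv_of_real field_simps)
  then have "cmod (cinner x y) = inner (c *\<^sub>C x) y"
    by (simp add: inner_scaleC_left)
  also have "\<dots> \<le> norm (c *\<^sub>C x) * norm y"
    by (rule norm_cauchy_schwarz)
  also have "cmod c = 1" using False by (simp add: c_def norm_sgn)
  then have "norm (c *\<^sub>C x) * norm y = norm x * norm y" by simp
  finally show ?thesis .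
qed simp

lemma bounded_linear_cinner_left:
  "bounded_linear (\<lambda>x. cinner x (y::'a::complex_hilbert_space))"
proof (rule bounded_linear_intro[where K="norm y"])
  fix a x
  show "cinner (a *\<^sub>R x) y = a *\<^sub>R cinner x y"
    by (metis cinner_scaleC_left scaleC_of_real scaleR_conv_of_real)
qed (simp_all add: cinner_add_left cmod_cinner_le)

lemma bounded_clinear_id: "bounded_clinear (\<lambda>x. x)"
  by (simp add: bounded_clinear_def)

lemma bounded_clinear_compose:
  "bounded_clinear f \<Longrightarrow> bounded_clinear g \<Longrightarrow> bounded_clinear (\<lambda>x. f (g x))"
  by (auto simp: bounded_clinear_def intro: bounded_linear_compose)

lemma bounded_clinear_funpow:
  fixes X :: "'a::complex_hilbert_space \<Rightarrow> 'a"
  shows "bounded_clinear X \<Longrightarrow> bounded_clinear (X ^^ n)"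
proof (induction n)
  case 0
  have "X ^^ 0 = (\<lambda>x. x)" by auto
  then show ?case by (simp only: bounded_clinear_id)
next
  case (Suc n) then show ?case using bounded_clinear_compose[of X "X ^^ n"] by (simp add: o_def)
qed

lemma bounded_clinear_scaleC: "bounded_clinear f \<Longrightarrow> bounded_clinear (\<lambda>x. c *\<^sub>C f x)"
  by (auto simp: bounded_clinear_def scaleC_scaleC mult.commute
      intro: bounded_linear_compose[OF bounded_linear_scaleC])

lemma bounded_clinear_scaleR: "bounded_clinear f \<Longrightarrow> bounded_clinear (\<lambda>x. a *\<^sub>R f x)"
  using bounded_clinear_scaleC[of f "of_real a"] by (simp add: scaleC_of_real)

lemma bounded_clinearD:
  assumes "bounded_clinear X"
  shows "bounded_linear X" "X (x + y) = X x + X y" "X (x - y) = X x - X y"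
    "X (c *\<^sub>C x) = c *\<^sub>C X x" "X (a *\<^sub>R x) = a *\<^sub>R X x" "X 0 = 0"
    "X (sum f A) = (\<Sum>i\<in>A. X (f i))"
  using assms unfolding bounded_clinear_def
  by (auto simp: bounded_linear.linear linear_add linear_diff linear_scale linear_0 linear_sum)

section \<open>The square root of 1 - z\<close>

text \<open>The Taylor coefficients of \<open>\<surd>(1 - z)\<close>.\<close>

definition sqrt_coeff :: "nat \<Rightarrow> real" where
  "sqrt_coeff j = (-1) ^ j * ((1/2) gchoose j)"

lemma sqrt_coeff_0 [simp]: "sqrt_coeff 0 = 1"
  by (simp add: sqrt_coeff_def)

lemma sqrt_coeff_Suc_nonpos: "sqrt_coeff (Suc j) \<le> 0"
proof (induction j)
  case 0
  show ?case by (simp add: sqrt_coeff_def)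
next
  case (Suc j)
  have "((1/2::real) gchoose Suc (Suc j)) = - ((real j + 1/2) / (real j + 2)) * (1/2 gchoose Suc j)"
    using gbinomial_mult_1[of "1/2::real" "Suc j"] by (simp add: field_simps)
  then have "sqrt_coeff (Suc (Suc j)) = sqrt_coeff (Suc j) * ((real j + 1/2) / (real j + 2))"
    by (simp add: sqrt_coeff_def)
  then show ?case
    using mult_nonpos_nonneg[OF Suc, of "(real j + 1/2) / (real j + 2)"] by simp
qed

lemma alternating_gbinomial_neg_half_nonneg: "(-1) ^ n * ((-1/2::real) gchoose n) \<ge> 0"
proof (induction n)
  case (Suc n)
  have "((-1/2::real) gchoose Suc n) = - ((real n + 1/2) / (real n + 1)) * (-1/2 gchoose n)"
    using gbinomial_mult_1[of "-1/2::real" n] by (simp add: field_simps)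
  then have "(-1) ^ Suc n * ((-1/2::real) gchoose Suc n)
      = ((-1) ^ n * ((-1/2::real) gchoose n)) * ((real n + 1/2) / (real n + 1))"
    by simp
  then show ?case using Suc by simp
qed simp

text \<open>All coefficients except the first are negative, so the sum of their absolute values is two minus the
partial sum of \<open>(1 - z)\<^sup>1\<^sup>/\<^sup>2\<close> at \<open>z = 1\<close>. That partial sum is a coefficient of \<open>(1 - z)\<^sup>-\<^sup>1\<^sup>/\<^sup>2\<close>,
which is positive.\<close>

lemma sum_abs_sqrt_coeff_le: "(\<Sum>j<n. \<bar>sqrt_coeff j\<bar>) \<le> 2"
proof -
  have "(\<Sum>j\<le>n. \<bar>sqrt_coeff j\<bar>) \<le> 2"
  proof -
    have "(\<Sum>j\<le>n. \<bar>sqrt_coeff j\<bar>) = (\<Sum>j\<le>n. (if j = 0 then 2 else 0) - sqrt_coeff j)"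
    proof (rule sum.cong)
      fix j show "\<bar>sqrt_coeff j\<bar> = (if j = 0 then 2 else 0) - sqrt_coeff j"
        using sqrt_coeff_Suc_nonpos[of "j - 1"] by (cases j) auto
    qed simp
    also have "\<dots> = 2 - (\<Sum>j\<le>n. (1/2 gchoose j) * (-1) ^ j)"
      by (simp add: sum_subtractf sqrt_coeff_def mult.commute)
    also have "\<dots> = 2 - (-1) ^ n * ((-1/2) gchoose n)"
      by (subst gbinomial_sum_lower_neg) simp
    finally show ?thesis using alternating_gbinomial_neg_half_nonneg[of n] by simp
  qed
  moreover have "(\<Sum>j<n. \<bar>sqrt_coeff j\<bar>) \<le> (\<Sum>j\<le>n. \<bar>sqrt_coeff j\<bar>)"
    by (intro sum_mono2) auto
  ultimately show ?thesis by linarith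
qed

lemma summable_abs_sqrt_coeff: "summable (\<lambda>j. \<bar>sqrt_coeff j\<bar>)"
  by (rule summableI_nonneg_bounded[of _ 2]) (simp_all add: sum_abs_sqrt_coeff_le)

lemma suminf_abs_sqrt_coeff_le: "(\<Sum>j. \<bar>sqrt_coeff j\<bar>) \<le> 2"
  by (rule suminf_le_const[OF summable_abs_sqrt_coeff sum_abs_sqrt_coeff_le])

lemma sqrt_coeff_convolution:
  "(\<Sum>i\<le>n. sqrt_coeff i * sqrt_coeff (n - i)) = (if n = 0 then 1 else if n = 1 then -1 else 0)"
proof -
  have "(\<Sum>i\<le>n. sqrt_coeff i * sqrt_coeff (n - i))
      = (\<Sum>i\<le>n. (-1) ^ n * ((1/2 gchoose i) * (1/2 gchoose (n - i))))"
    by (rule sum.cong) (auto simp: sqrt_coeff_def simp flip: power_add)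
  also have "\<dots> = (-1) ^ n * ((1::real) gchoose n)"
    using gbinomial_Vandermonde[of "1/2::real" "1/2" n] by (simp flip: sum_distrib_left add: atLeast0AtMost)
  also have "(1::real) gchoose n = of_nat (1 choose n)"
    by (metis binomial_gbinomial of_nat_1)
  finally show ?thesis by (cases n; cases "n - 1") auto
qed

text \<open>This one identity contains both \<open>((1 - z)\<^sup>1\<^sup>/\<^sup>2)\<^sup>2 = 1 - z\<close> on the closed disc (\<open>\<phi> n = z\<^sup>n\<close>) and its
operator version (\<open>\<phi> n = X\<^sup>n x\<close>). It holds because absolute convergence permits summation along the
antidiagonals, where Vandermonde's identity applies.\<close>

lemma sqrt_coeff_double_sum:
  fixes \<phi> :: "nat \<Rightarrow> 'b::banach"
  assumes bd: "\<And>n. norm (\<phi> n) \<le> K"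
  shows "(\<Sum>i. \<Sum>j. (sqrt_coeff i * sqrt_coeff j) *\<^sub>R \<phi> (i + j)) = \<phi> 0 - \<phi> 1"
proof -
  let ?a = sqrt_coeff
  let ?f = "\<lambda>(i,j). (?a i * ?a j) *\<^sub>R \<phi> (i + j)"
  have K: "K \<ge> 0" using order_trans[OF norm_ge_zero bd[of 0]] .
  have suma: "(\<lambda>i. norm (?a i)) summable_on UNIV"
    using norm_summable_imp_summable_on[of "\<lambda>j. norm (?a j)"] summable_abs_sqrt_coeff by simp
  have sum_aa: "(\<lambda>p. norm (case p of (i,j) \<Rightarrow> ?a i * ?a j)) summable_on (UNIV \<times> UNIV)"
    by (subst Infinite_Sum.abs_summable_on_Sigma_iff)
       (use suma in \<open>auto simp: abs_mult infsum_cmult_right' intro!: summable_on_cmult_right summable_on_cmult_left\<close>)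
  have absf: "(\<lambda>p. norm (?f p)) summable_on (UNIV \<times> UNIV)"
  proof (rule Infinite_Sum.abs_summable_on_comparison_test)
    show "(\<lambda>p. norm (K * (case p of (i,j) \<Rightarrow> ?a i * ?a j))) summable_on (UNIV \<times> UNIV)"
      using sum_aa by (simp add: abs_mult norm_mult summable_on_cmult_right split_def)
    show "norm (?f p) \<le> norm (K * (case p of (i,j) \<Rightarrow> ?a i * ?a j))" for p
      using bd K by (auto simp: split_def abs_mult mult.commute mult_right_mono)
  qed
  then have sf: "?f summable_on (UNIV \<times> UNIV)"
    by (rule abs_summable_summable)
  have summ: "summable (\<lambda>j. norm ((?a i * ?a j) *\<^sub>R \<phi> (i + j)))" for i
  proof (rule summable_comparison_test')
    show "summable (\<lambda>j. \<bar>?a i\<bar> * K * \<bar>?a j\<bar>)"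
      by (intro summable_mult summable_abs_sqrt_coeff)
    show "norm (norm ((?a i * ?a j) *\<^sub>R \<phi> (i + j))) \<le> \<bar>?a i\<bar> * K * \<bar>?a j\<bar>" if "j \<ge> 0" for j
      using mult_left_mono[OF bd[of "i+j"], of "\<bar>?a i\<bar> * \<bar>?a j\<bar>"] by (simp add: abs_mult mult_ac)
  qed
  have inner_sum: "((\<lambda>j. ?f (i,j)) has_sum (\<Sum>j. (?a i * ?a j) *\<^sub>R \<phi> (i + j))) UNIV" for i
    using norm_summable_imp_has_sum[OF summ[of i] summable_sums[OF summable_norm_cancel[OF summ[of i]]]]
    by simp
  have "((\<lambda>i. \<Sum>j. (?a i * ?a j) *\<^sub>R \<phi> (i + j)) has_sum infsum ?f (UNIV \<times> UNIV)) UNIV"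
    by (rule has_sum_SigmaD[OF has_sum_infsum[OF sf]]) (use inner_sum in auto)
  then have lhs: "(\<lambda>i. \<Sum>j. (?a i * ?a j) *\<^sub>R \<phi> (i + j)) sums infsum ?f (UNIV \<times> UNIV)"
    by (rule has_sum_imp_sums)
  let ?B = "\<lambda>n::nat. {..n}"
  let ?g = "\<lambda>(n,i). (?a i * ?a (n - i)) *\<^sub>R \<phi> n"
  have re: "infsum ?f (UNIV \<times> UNIV) = infsum ?g (Sigma UNIV ?B)"
    by (rule infsum_reindex_bij_witness[where i="\<lambda>(n,i). (i, n - i)" and j="\<lambda>(i,j). (i + j, i)"]) auto
  have sg: "?g summable_on (Sigma UNIV ?B)"
    using sf by (subst summable_on_reindex_bij_witness[where j="\<lambda>(n,i). (i, n - i)" and i="\<lambda>(i,j). (i + j, i)"]) auto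
  have "((\<lambda>n. \<Sum>i\<le>n. (?a i * ?a (n - i)) *\<^sub>R \<phi> n) has_sum infsum ?g (Sigma UNIV ?B)) UNIV"
    by (rule has_sum_SigmaD[OF has_sum_infsum[OF sg]]) (auto intro!: has_sum_finiteI)
  then have "(\<lambda>n. (\<Sum>i\<le>n. ?a i * ?a (n - i)) *\<^sub>R \<phi> n) sums infsum ?g (Sigma UNIV ?B)"
    by (simp add: has_sum_imp_sums flip: scaleR_sum_left)
  moreover have "(\<lambda>n. (\<Sum>i\<le>n. ?a i * ?a (n - i)) *\<^sub>R \<phi> n) sums
      (\<Sum>n\<in>{0,1}. (\<Sum>i\<le>n. ?a i * ?a (n - i)) *\<^sub>R \<phi> n)"
    by (rule sums_finite) (auto simp: sqrt_coeff_convolution)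
  ultimately have "infsum ?g (Sigma UNIV ?B) = (\<Sum>n\<in>{0,1}. (\<Sum>i\<le>n. ?a i * ?a (n - i)) *\<^sub>R \<phi> n)"
    by (rule sums_unique2)
  also have "\<dots> = \<phi> 0 - \<phi> 1"
    by (simp add: sqrt_coeff_convolution)
  finally show ?thesis
    unfolding sums_unique[OF lhs, symmetric] re .
qed

definition csqrt_series :: "complex \<Rightarrow> complex" where
  "csqrt_series z = (\<Sum>j. of_real (sqrt_coeff j) * z ^ j)"

lemma norm_csqrt_series_squared:
  assumes "cmod z \<le> 1" shows "(cmod (csqrt_series z))\<^sup>2 = cmod (1 - z)"
proof -
  have sm: "summable (\<lambda>j. norm (of_real (sqrt_coeff j) * z ^ j))"
    by (rule summable_comparison_test'[OF summable_abs_sqrt_coeff])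
       (use assms in \<open>auto simp: norm_mult norm_power intro!: mult_left_le power_le_one\<close>)
  note s = summable_norm_cancel[OF sm]
  have "(\<Sum>i. \<Sum>j. (sqrt_coeff i * sqrt_coeff j) *\<^sub>R z ^ (i + j)) = z ^ 0 - z ^ 1"
    by (rule sqrt_coeff_double_sum[where K=1]) (use assms in \<open>auto simp: norm_power intro!: power_le_one\<close>)
  also have "(\<Sum>i. \<Sum>j. (sqrt_coeff i * sqrt_coeff j) *\<^sub>R z ^ (i + j))
     = (\<Sum>i. (of_real (sqrt_coeff i) * z ^ i) * csqrt_series z)"
    unfolding csqrt_series_def
    by (subst suminf_mult[OF s, symmetric]) (simp add: scaleR_conv_of_real power_add mult_ac)
  also have "\<dots> = csqrt_series z * csqrt_series z"
    unfolding csqrt_series_def by (rule suminf_mult2[OF s, symmetric])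
  finally show ?thesis by (simp add: power2_eq_square flip: norm_mult)
qed

definition power_bounded_by :: "real \<Rightarrow> ('a::complex_hilbert_space \<Rightarrow> 'a) \<Rightarrow> bool" where
  "power_bounded_by K X \<longleftrightarrow> bounded_clinear X \<and> (\<forall>n x. norm ((X ^^ n) x) \<le> K * norm x)"

definition sqrt_one_minus :: "('a::complex_hilbert_space \<Rightarrow> 'a) \<Rightarrow> 'a \<Rightarrow> 'a" where
  "sqrt_one_minus X x = (\<Sum>j. sqrt_coeff j *\<^sub>R (X ^^ j) x)"

context
  fixes K :: real and X :: "'a::complex_hilbert_space \<Rightarrow> 'a"
  assumes pb: "power_bounded_by K X"
begin

lemma power_bounded_by_clinear: "bounded_clinear X"
  using pb by (simp add: power_bounded_by_def)

lemma power_bounded_by_norm_le: "norm ((X ^^ n) x) \<le> K * norm x"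
  using pb by (simp add: power_bounded_by_def)

lemma summable_sqrt_one_minus_norm: "summable (\<lambda>j. norm (sqrt_coeff j *\<^sub>R (X ^^ j) x))"
proof (rule summable_comparison_test')
  show "summable (\<lambda>j. K * norm x * \<bar>sqrt_coeff j\<bar>)"
    by (intro summable_mult summable_abs_sqrt_coeff)
  show "norm (norm (sqrt_coeff j *\<^sub>R (X ^^ j) x)) \<le> K * norm x * \<bar>sqrt_coeff j\<bar>" for j
    using mult_left_mono[OF power_bounded_by_norm_le[of j x], of "\<bar>sqrt_coeff j\<bar>"] by (simp add: mult_ac)
qed

lemma sums_sqrt_one_minus: "(\<lambda>j. sqrt_coeff j *\<^sub>R (X ^^ j) x) sums sqrt_one_minus X x"
  unfolding sqrt_one_minus_def
  by (rule summable_sums[OF summable_norm_cancel[OF summable_sqrt_one_minus_norm]])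

lemma norm_sqrt_one_minus_le: "norm (sqrt_one_minus X x) \<le> 2 * K * norm x"
proof -
  have "norm (sqrt_one_minus X x) \<le> (\<Sum>j. norm (sqrt_coeff j *\<^sub>R (X ^^ j) x))"
    unfolding sqrt_one_minus_def by (rule summable_norm[OF summable_sqrt_one_minus_norm])
  also have "\<dots> \<le> (\<Sum>j. K * norm x * \<bar>sqrt_coeff j\<bar>)"
  proof (rule suminf_le[OF _ summable_sqrt_one_minus_norm])
    show "norm (sqrt_coeff j *\<^sub>R (X ^^ j) x) \<le> K * norm x * \<bar>sqrt_coeff j\<bar>" for j
      using mult_left_mono[OF power_bounded_by_norm_le[of j x], of "\<bar>sqrt_coeff j\<bar>"] by (simp add: mult_ac)
  qed (intro summable_mult summable_abs_sqrt_coeff)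
  also have "\<dots> = K * norm x * (\<Sum>j. \<bar>sqrt_coeff j\<bar>)"
    by (rule suminf_mult[OF summable_abs_sqrt_coeff])
  also have "\<dots> \<le> K * norm x * 2"
    using suminf_abs_sqrt_coeff_le order_trans[OF norm_ge_zero power_bounded_by_norm_le[of 0 x]]
    by (intro mult_left_mono) auto
  finally show ?thesis by (simp add: mult_ac)
qed

lemma sqrt_one_minus_commute:
  assumes L: "bounded_linear L" and c: "\<And>j x. L ((X ^^ j) x) = (X ^^ j) (L x)"
  shows "L (sqrt_one_minus X x) = sqrt_one_minus X (L x)"
proof -
  have "(\<lambda>j. L (sqrt_coeff j *\<^sub>R (X ^^ j) x)) sums L (sqrt_one_minus X x)"
    by (rule bounded_linear.sums[OF L sums_sqrt_one_minus])
  then have "(\<lambda>j. sqrt_coeff j *\<^sub>R (X ^^ j) (L x)) sums L (sqrt_one_minus X x)"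
    using c L by (simp add: linear_scale bounded_linear.linear)
  then show ?thesis using sums_unique2 sums_sqrt_one_minus by blast
qed

lemma bounded_clinear_sqrt_one_minus: "bounded_clinear (sqrt_one_minus X)"
  unfolding bounded_clinear_def
proof (intro conjI allI)
  note lin = bounded_clinearD[OF bounded_clinear_funpow[OF power_bounded_by_clinear]]
  show c: "sqrt_one_minus X (c *\<^sub>C x) = c *\<^sub>C sqrt_one_minus X x" for c x
    using sqrt_one_minus_commute[OF bounded_linear_scaleC] lin by simp
  show "bounded_linear (sqrt_one_minus X)"
  proof (rule bounded_linear_intro[where K="2 * K"])
    show "sqrt_one_minus X (x + y) = sqrt_one_minus X x + sqrt_one_minus X y" for x y
      using sums_add[OF sums_sqrt_one_minus[of x] sums_sqrt_one_minus[of y]]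
        sums_sqrt_one_minus[of "x + y"] lin sums_unique2
      by (fastforce simp: scaleR_add_right)
    show "sqrt_one_minus X (a *\<^sub>R x) = a *\<^sub>R sqrt_one_minus X x" for a x
      using c[of "of_real a" x] by (simp add: scaleC_of_real)
  qed (use norm_sqrt_one_minus_le in \<open>simp add: mult_ac\<close>)
qed

lemma funpow_swap: "(X ^^ n) ((X ^^ j) x) = (X ^^ j) ((X ^^ n) x)"
  by (metis add.commute comp_apply funpow_add)

lemma sqrt_one_minus_funpow: "(X ^^ n) (sqrt_one_minus X x) = sqrt_one_minus X ((X ^^ n) x)"
  by (rule sqrt_one_minus_commute)
     (simp_all add: bounded_clinearD[OF bounded_clinear_funpow[OF power_bounded_by_clinear]] funpow_swap)

lemma sqrt_one_minus_squared: "sqrt_one_minus X (sqrt_one_minus X x) = x - X x"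
proof -
  let ?B = "sqrt_one_minus X x"
  note lin = bounded_clinearD[OF bounded_clinear_funpow[OF power_bounded_by_clinear]]
  have shifted: "(\<lambda>j. sqrt_coeff j *\<^sub>R (X ^^ (i + j)) x) sums (X ^^ i) ?B" for i
    using bounded_linear.sums[OF lin(1) sums_sqrt_one_minus, of i x]
    by (simp add: lin funpow_add)
  have "(\<lambda>j. (sqrt_coeff i * sqrt_coeff j) *\<^sub>R (X ^^ (i + j)) x) sums (sqrt_coeff i *\<^sub>R (X ^^ i) ?B)" for i
    using bounded_linear.sums[OF bounded_linear_scaleR_right[of "sqrt_coeff i"] shifted] by simp
  then have "(\<Sum>j. (sqrt_coeff i * sqrt_coeff j) *\<^sub>R (X ^^ (i + j)) x) = sqrt_coeff i *\<^sub>R (X ^^ i) ?B" for i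
    by (rule sums_unique[symmetric])
  then have "sqrt_one_minus X ?B
      = (\<Sum>i. \<Sum>j. (sqrt_coeff i * sqrt_coeff j) *\<^sub>R (X ^^ (i + j)) x)"
    by (simp add: sqrt_one_minus_def[of X ?B])
  also have "\<dots> = (X ^^ 0) x - (X ^^ 1) x"
    by (rule sqrt_coeff_double_sum[OF power_bounded_by_norm_le])
  finally show ?thesis by simp
qed

end

section \<open>Equivalent Hilbert norms and similarity\<close>

text \<open>The representing vector is the minimiser of \<open>\<parallel>x\<parallel>\<^sup>2 - 2 f x\<close>; the parallelogram law makes every
minimising sequence a Cauchy sequence.\<close>

lemma riesz_representation:
  fixes f :: "'a::{real_inner,banach} \<Rightarrow> real"
  assumes "bounded_linear f"
  obtains z where "\<And>x. f x = inner z x"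
proof -
  interpret f: bounded_linear f by fact
  define \<Phi> where "\<Phi> x = (norm x)\<^sup>2 - 2 * f x" for x
  obtain K where K: "\<And>x. norm (f x) \<le> norm x * K" using f.bounded by blast
  have low: "\<Phi> x \<ge> - K\<^sup>2" for x
  proof -
    have "0 \<le> (norm x - K)\<^sup>2" by simp
    also have "\<dots> \<le> (norm x)\<^sup>2 - 2 * f x + K\<^sup>2"
      using K[of x] by (simp add: power2_diff abs_le_iff)
    finally show ?thesis by (simp add: \<Phi>_def)
  qed
  define d where "d = Inf (range \<Phi>)"
  have bdd: "bdd_below (range \<Phi>)" using low by (auto intro!: bdd_belowI)
  then have d: "d \<le> \<Phi> x" for x unfolding d_def by (auto intro: cInf_lower)
  have "\<exists>x. \<Phi> x < d + 1 / (real n + 1)" for n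
    using cInf_lessD[of "range \<Phi>" "d + 1 / (real n + 1)"] by (auto simp: d_def)
  then obtain X where X: "\<And>n. \<Phi> (X n) < d + 1 / (real n + 1)" by metis
  have close: "(norm (x - y))\<^sup>2 \<le> 2 * \<Phi> x + 2 * \<Phi> y - 4 * d" for x y
  proof -
    have "(norm (x - y))\<^sup>2 = 2 * \<Phi> x + 2 * \<Phi> y - 4 * \<Phi> ((1/2) *\<^sub>R (x + y))"
      by (simp add: \<Phi>_def f.add f.scaleR power2_norm_eq_inner inner_commute algebra_simps)
    then show ?thesis using d[of "(1/2) *\<^sub>R (x + y)"] by linarith
  qed
  have "Cauchy X"
  proof (rule metric_CauchyI)
    fix e :: real assume e: "e > 0"
    then obtain N where N: "1 / (real N + 1) < e\<^sup>2 / 4"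
      using reals_Archimedean[of "e\<^sup>2/4"] by (auto simp: inverse_eq_divide add.commute)
    show "\<exists>M. \<forall>m\<ge>M. \<forall>n\<ge>M. dist (X m) (X n) < e"
    proof (intro exI[of _ N] allI impI)
      fix m n assume "m \<ge> N" "n \<ge> N"
      then have "1 / (real m + 1) \<le> 1 / (real N + 1)" "1 / (real n + 1) \<le> 1 / (real N + 1)"
        by (auto intro!: divide_left_mono)
      then have "(norm (X m - X n))\<^sup>2 < e\<^sup>2"
        using close[of "X m" "X n"] X[of m] X[of n] N by linarith
      then show "dist (X m) (X n) < e"
        using e by (simp add: dist_norm power2_less_imp_less)
    qed
  qed
  then obtain z where z: "X \<longlonglongrightarrow> z" by (auto simp: Cauchy_convergent_iff convergent_def)
  have lim: "(\<lambda>n. d + 1 / (real n + 1)) \<longlonglongrightarrow> d + 0"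
    by (intro tendsto_add tendsto_const LIMSEQ_Suc[OF lim_1_over_n, simplified, unfolded of_nat_Suc add.commute[of 1]])
  have "(\<lambda>n. \<Phi> (X n)) \<longlonglongrightarrow> \<Phi> z"
    unfolding \<Phi>_def by (intro tendsto_intros z f.tendsto)
  then have zd: "\<Phi> z \<le> d"
    using LIMSEQ_le[OF _ lim, of "\<lambda>n. \<Phi> (X n)"] X by (force intro: less_imp_le)
  have "f y = inner z y" for y
  proof (cases "y = 0")
    case True then show ?thesis by (simp add: f.zero)
  next
    case False
    define e where "e = inner z y - f y"
    define t where "t = - e / inner y y"
    have yy: "inner y y > 0" using False by simp
    have "\<Phi> (z + t *\<^sub>R y) = \<Phi> z + 2 * t * e + t\<^sup>2 * inner y y"
      unfolding \<Phi>_def e_def power2_norm_eq_inner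
      by (simp add: f.add f.scaleR inner_commute algebra_simps power2_eq_square)
    also have "\<dots> = \<Phi> z - e\<^sup>2 / inner y y"
      using yy by (simp add: t_def field_simps power2_eq_square)
    finally have "e\<^sup>2 / inner y y \<le> 0"
      using zd d[of "z + t *\<^sub>R y"] by linarith
    then have "e = 0" using yy by (simp add: divide_le_0_iff)
    then show ?thesis by (simp add: e_def)
  qed
  then show ?thesis using that by blast
qed

lemma nonneg_form_Cauchy_Schwarz:
  fixes N :: "'a::real_inner \<Rightarrow> 'a \<Rightarrow> real"
  assumes lin: "\<And>x. linear (N x)" and sym: "\<And>x y. N x y = N y x"
    and pos: "\<And>x. 0 \<le> N x x" and upper: "\<And>x. N x x \<le> M * (norm x)\<^sup>2"
  shows "\<bar>N x y\<bar> \<le> M * norm x * norm y"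
proof (cases "x = 0 \<or> y = 0")
  case True
  then have "N x y = 0" using linear_0[OF lin[of x]] linear_0[OF lin[of y]] sym[of x y] by auto
  then show ?thesis using True by auto
next
  case False
  have ladd: "N (u + v) w = N u w + N v w" "N w (u + v) = N w u + N w v"
    and ldiff: "N (u - v) w = N u w - N v w" "N w (u - v) = N w u - N w v"
    and lsc: "N (a *\<^sub>R u) w = a * N u w" "N w (a *\<^sub>R u) = a * N w u" for u v w a
    by (simp_all add: sym[of _ w] linear_add[OF lin] linear_diff[OF lin] linear_scale[OF lin])
  let ?x = "x /\<^sub>R norm x" and ?y = "y /\<^sub>R norm y"
  have "N ?x ?x \<le> M" "N ?y ?y \<le> M"
    using upper[of ?x] upper[of ?y] False by simp_all
  moreover have "0 \<le> N ?x ?x + N ?y ?y + 2 * N ?x ?y"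
    using pos[of "?x + ?y"] sym[of ?y ?x] by (simp only: ladd)
  moreover have "0 \<le> N ?x ?x + N ?y ?y - 2 * N ?x ?y"
    using pos[of "?x - ?y"] sym[of ?y ?x] by (simp only: ldiff)
  ultimately have "\<bar>N ?x ?y\<bar> \<le> M" by linarith
  also have "N ?x ?y = N x y / (norm x * norm y)"
    by (simp add: lsc field_simps)
  finally show ?thesis using False by (simp add: field_simps abs_mult)
qed

text \<open>The form is represented by a positive operator \<open>A\<close>, scaled so that \<open>D = 1 - A\<close> has norm less than
one. Then \<open>S = (1 - D)\<^sup>1\<^sup>/\<^sup>2\<close> satisfies \<open>\<parallel>S x\<parallel>\<^sup>2 = N x x / M\<close>, so contractivity of \<open>T\<close> for \<open>N\<close> is
contractivity of \<open>S T S\<^sup>-\<^sup>1\<close>. The compatibility of \<open>N\<close> with complex scalars makes \<open>S\<close> complex linear.\<close>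

lemma similar_to_contraction_if_form:
  fixes T :: "'a::complex_hilbert_space \<Rightarrow> 'a" and N :: "'a \<Rightarrow> 'a \<Rightarrow> real"
  assumes T: "bounded_clinear T"
    and lin: "\<And>x. linear (N x)" and sym: "\<And>x y. N x y = N y x"
    and cplx: "\<And>c x y. N (c *\<^sub>C x) y = N x (cnj c *\<^sub>C y)"
    and m: "0 < m" "m \<le> M" and lower: "\<And>x. m * (norm x)\<^sup>2 \<le> N x x"
    and upper: "\<And>x. N x x \<le> M * (norm x)\<^sup>2"
    and contr: "\<And>x. N (T x) (T x) \<le> N x x"
  shows "similar_to_contraction T"
proof -
  have M: "M > 0" using m by linarith
  have Nbound: "\<bar>N x y\<bar> \<le> M * norm x * norm y" for x y
    by (rule nonneg_form_Cauchy_Schwarz[OF lin sym _ upper])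
       (meson lower m(1) mult_nonneg_nonneg less_imp_le order_trans zero_le_power2)
  have "\<exists>z. \<forall>y. N x y / M = inner z y" for x
  proof -
    have "bounded_linear (\<lambda>y. N x y / M)"
    proof (rule bounded_linear_intro[where K="norm x"])
      show "norm (N x y / M) \<le> norm y * norm x" for y
        using Nbound[of x y] M by (simp add: field_simps abs_mult)
    qed (simp_all add: linear_add[OF lin] linear_scale[OF lin] add_divide_distrib)
    then show ?thesis using riesz_representation by metis
  qed
  then obtain A where A: "\<And>x y. inner (A x) y = N x y / M" by metis
  define D where "D x = x - A x" for x
  define q where "q = 1 - m / M"
  have q: "0 \<le> q" "q < 1" using m M by (auto simp: q_def)
  have Dsym: "inner (D x) y = inner x (D y)" for x y
    using A[of x y] A[of y x] sym[of x y] by (simp add: D_def inner_diff_left inner_diff_right inner_commute)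
  have Dc: "D (c *\<^sub>C x) = c *\<^sub>C D x" for c x
  proof -
    have "inner (D (c *\<^sub>C x)) y = inner (c *\<^sub>C D x) y" for y
    proof -
      have "inner (A (c *\<^sub>C x)) y = inner (c *\<^sub>C A x) y"
        unfolding inner_scaleC_cnj[of c "A x" y] A by (simp add: cplx)
      then show ?thesis by (simp add: D_def scaleC_diff_right inner_diff_left)
    qed
    then show ?thesis using vector_eq_rdot by blast
  qed
  have Dadd: "D (x + y) = D x + D y" for x y
  proof -
    have "inner (D (x + y)) z = inner (D x + D y) z" for z
      by (simp add: Dsym[of "x + y"] inner_add_left Dsym)
    then show ?thesis using vector_eq_rdot by blast
  qed
  have Dinner: "inner (D x) x = (norm x)\<^sup>2 - N x x / M" for x
    by (simp add: D_def inner_diff_left A power2_norm_eq_inner)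
  have Dpos: "0 \<le> inner (D x) x" "inner (D x) x \<le> q * (norm x)\<^sup>2" for x
    using upper[of x] lower[of x] M by (simp_all add: Dinner q_def field_simps)
  have Dscale: "D (a *\<^sub>R x) = a *\<^sub>R D x" for a x
    using Dc[of "of_real a" x] by (simp add: scaleC_of_real)
  have Dnorm: "norm (D x) \<le> q * norm x" for x
  proof -
    have "\<bar>inner (D x) (D x)\<bar> \<le> q * norm x * norm (D x)"
      by (rule nonneg_form_Cauchy_Schwarz[where N="\<lambda>x y. inner (D x) y"])
         (use Dpos Dsym inner_commute bounded_linear.linear[OF bounded_linear_inner_right] in metis)+
    then have "norm (D x) * norm (D x) \<le> q * norm x * norm (D x)"
      by (simp add: power2_eq_square flip: power2_norm_eq_inner)
    then show ?thesis using q by (cases "D x = 0") (auto dest: mult_right_le_imp_le)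
  qed
  have Dcl: "bounded_clinear D"
    unfolding bounded_clinear_def
    by (intro conjI allI bounded_linear_intro[where K=q]) (auto simp: Dc Dadd Dscale Dnorm mult.commute)
  have Dpow: "norm ((D ^^ n) x) \<le> q ^ n * norm x" for n x
  proof (induction n)
    case (Suc n)
    have "norm ((D ^^ Suc n) x) \<le> q * norm ((D ^^ n) x)" using Dnorm by simp
    also have "\<dots> \<le> q * (q ^ n * norm x)" using Suc q by (intro mult_left_mono) auto
    finally show ?case by (simp add: mult_ac)
  qed simp
  have pb: "power_bounded_by 1 D"
    unfolding power_bounded_by_def
  proof (intro conjI allI Dcl)
    fix n and x :: 'a
    have "q ^ n * norm x \<le> 1 * norm x" using q by (intro mult_right_mono power_le_one) auto
    then show "norm ((D ^^ n) x) \<le> 1 * norm x" using Dpow[of n x] by linarith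
  qed
  define S where "S = sqrt_one_minus D"
  have S: "bounded_clinear S" unfolding S_def by (rule bounded_clinear_sqrt_one_minus[OF pb])
  have SS: "S (S x) = A x" for x
    using sqrt_one_minus_squared[OF pb] by (simp add: S_def D_def)
  have Ssym: "inner (S x) y = inner x (S y)" for x y
  proof -
    have Dn: "inner ((D ^^ j) x) y = inner x ((D ^^ j) y)" for j
      by (induction j arbitrary: x y) (auto simp: Dsym funpow_swap1)
    have "(\<lambda>j. inner (sqrt_coeff j *\<^sub>R (D ^^ j) x) y) sums inner (S x) y"
      unfolding S_def by (rule bounded_linear.sums[OF bounded_linear_inner_left sums_sqrt_one_minus[OF pb]])
    moreover have "(\<lambda>j. inner x (sqrt_coeff j *\<^sub>R (D ^^ j) y)) sums inner x (S y)"
      unfolding S_def by (rule bounded_linear.sums[OF bounded_linear_inner_right sums_sqrt_one_minus[OF pb]])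
    ultimately show ?thesis by (intro sums_unique2) (simp_all add: Dn)
  qed
  have Snorm: "(norm (S x))\<^sup>2 = N x x / M" for x
    by (simp add: power2_norm_eq_inner Ssym[of x "S x"] SS A inner_commute[of x "A x"])
  have Sinj: "inj S"
  proof (rule injI)
    fix x y assume "S x = S y"
    then have "S (x - y) = 0" by (simp add: bounded_clinearD[OF S])
    then have "N (x - y) (x - y) = 0" using Snorm[of "x - y"] M by simp
    then have "m * (norm (x - y))\<^sup>2 \<le> 0" using lower[of "x - y"] by simp
    then show "x = y" using m by (simp add: mult_le_0_iff)
  qed
  have Ssurj: "surj S"
  proof (rule surjI)
    fix y
    have sm: "summable (\<lambda>n. (D ^^ n) y)"
      by (rule summable_comparison_test'[where g="\<lambda>n. q ^ n * norm y" and N=0])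
         (use Dpow q in \<open>auto intro!: summable_mult2 summable_geometric\<close>)
    define z where "z = (\<Sum>n. (D ^^ n) y)"
    have "D z = (\<Sum>n. (D ^^ Suc n) y)"
      unfolding z_def by (simp add: bounded_linear.suminf[OF bounded_clinearD(1)[OF Dcl] sm])
    then have "D z = z - y" using suminf_split_head[OF sm] by (simp add: z_def)
    then show "S (S (\<Sum>n. (D ^^ n) y)) = y" unfolding SS z_def[symmetric] by (simp add: D_def)
  qed
  define S' where "S' = inv S"
  have S1: "S (S' y) = y" and S2: "S' (S y) = y" for y
    using Sinj Ssurj by (auto simp: S'_def surj_f_inv_f)
  have S'norm: "norm (S' y) \<le> norm y * sqrt (M / m)" for y
  proof -
    have "(norm y)\<^sup>2 = N (S' y) (S' y) / M" using Snorm[of "S' y"] S1 by simp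
    then have "m * (norm (S' y))\<^sup>2 \<le> M * (norm y)\<^sup>2" using lower[of "S' y"] M by (simp add: field_simps)
    then have "(norm (S' y))\<^sup>2 \<le> (norm y * sqrt (M / m))\<^sup>2"
      using m M by (simp add: power_mult_distrib field_simps)
    then show ?thesis by (rule power2_le_imp_le) (use m M in auto)
  qed
  have S': "bounded_clinear S'"
    unfolding bounded_clinear_def
  proof (intro conjI allI bounded_linear_intro[where K="sqrt (M / m)"] S'norm)
    show "S' (x + y) = S' x + S' y" for x y
      by (rule injD[OF Sinj]) (simp add: S1 bounded_clinearD[OF S])
    show "S' (c *\<^sub>C x) = c *\<^sub>C S' x" for c x
      by (rule injD[OF Sinj]) (simp add: S1 bounded_clinearD[OF S])
    show "S' (a *\<^sub>R x) = a *\<^sub>R S' x" for a x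
      by (rule injD[OF Sinj]) (simp add: S1 bounded_clinearD[OF S])
  qed
  have "norm ((S \<circ> T \<circ> S') y) \<le> 1 * norm y" for y
  proof -
    have "(norm (S (T (S' y))))\<^sup>2 \<le> (norm (S (S' y)))\<^sup>2"
      unfolding Snorm using contr[of "S' y"] M by (simp add: divide_right_mono)
    then have "norm (S (T (S' y))) \<le> norm y" unfolding S1 by (rule power2_le_imp_le) simp
    then show ?thesis by simp
  qed
  then have "onorm (S \<circ> T \<circ> S') \<le> 1" by (intro onorm_bound) auto
  then show ?thesis unfolding similar_to_contraction_def
    using S S' S1 S2 by (intro exI[of _ S] exI[of _ S']) (auto simp: fun_eq_iff)
qed

section \<open>Trigonometric integrals\<close>

lemma has_integral_cis:
  "((\<lambda>\<theta>. cis (of_int q * \<theta>)) has_integral (if q = 0 then 2 * of_real pi else 0)) {-pi..pi}"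
proof (cases "q = 0")
  case True
  then show ?thesis using has_integral_const_real[of "1::complex" "-pi" pi]
    by (simp add: scaleR_conv_of_real)
next
  case False
  have "((\<lambda>\<theta>. cis (of_int q * \<theta>)) has_integral
      (cis (of_int q * pi) / (\<i> * of_int q) - cis (of_int q * (-pi)) / (\<i> * of_int q))) {-pi..pi}"
  proof (rule fundamental_theorem_of_calculus)
    fix x :: real
    have "((\<lambda>z. exp (\<i> * of_int q * z) / (\<i> * of_int q)) has_field_derivative exp (\<i> * of_int q * of_real x))
        (at (of_real x))"
      using False by (auto intro!: derivative_eq_intros)
    from has_vector_derivative_real_field[OF this]
    show "((\<lambda>x. cis (of_int q * x) / (\<i> * of_int q)) has_vector_derivative cis (of_int q * x))
        (at x within {-pi..pi})"
      by (simp add: cis_conv_exp mult_ac has_vector_derivative_at_within)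
  qed simp
  moreover have "cis (of_int q * pi) = cis (of_int q * (-pi))"
  proof (rule complex_eqI)
    show "Im (cis (of_int q * pi)) = Im (cis (of_int q * (-pi)))"
      by (simp add: sin_integer_2pi mult.commute[of _ pi] sin_npi_int)
  qed simp
  ultimately show ?thesis using False by simp
qed

text \<open>Both the expansion of the resolvent and that of \<open>(1 - e\<^sup>-\<^sup>i\<^sup>\<theta>)\<^sup>1\<^sup>/\<^sup>2\<close> are absolutely convergent
trigonometric series, hence converge uniformly and can be integrated term by term against any
continuous function.\<close>

lemma has_integral_trig_series_mult:
  fixes f :: "nat \<Rightarrow> complex" and p :: "nat \<Rightarrow> real" and G :: "real \<Rightarrow> complex"
  assumes f: "summable (\<lambda>m. norm (f m))" and G: "continuous_on {a..b} G"
    and I: "\<And>m. ((\<lambda>\<theta>. cis (p m * \<theta>) * G \<theta>) has_integral I m) {a..b}"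
    and S: "(\<lambda>m. f m * I m) sums S"
  shows "((\<lambda>\<theta>. (\<Sum>m. f m * cis (p m * \<theta>)) * G \<theta>) has_integral S) {a..b}"
proof -
  let ?u = "\<lambda>n \<theta>. \<Sum>m<n. f m * cis (p m * \<theta>)"
  have ul: "uniform_limit {a..b} ?u (\<lambda>\<theta>. \<Sum>m. f m * cis (p m * \<theta>)) sequentially"
    by (rule Weierstrass_m_test[OF _ f]) (simp add: norm_mult)
  have cu: "continuous_on {a..b} (?u n)" for n
    by (intro continuous_intros continuous_on_cis)
  have cl: "continuous_on {a..b} (\<lambda>\<theta>. \<Sum>m. f m * cis (p m * \<theta>))"
    by (rule uniform_limit_theorem[OF _ ul]) (use cu in auto)
  have bl: "bounded ((\<lambda>\<theta>. \<Sum>m. f m * cis (p m * \<theta>)) ` {a..b})" "bounded (G ` {a..b})"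
    by (intro compact_imp_bounded compact_continuous_image cl G compact_Icc)+
  have "uniform_limit {a..b} (\<lambda>n \<theta>. ?u n \<theta> * G \<theta>) (\<lambda>\<theta>. (\<Sum>m. f m * cis (p m * \<theta>)) * G \<theta>) sequentially"
    by (intro uniform_lim_mult[OF ul _ bl] uniform_limit_const)
  then obtain I' J where I': "\<And>n. ((\<lambda>\<theta>. ?u n \<theta> * G \<theta>) has_integral I' n) {a..b}"
    and J: "((\<lambda>\<theta>. (\<Sum>m. f m * cis (p m * \<theta>)) * G \<theta>) has_integral J) {a..b}" and lim: "I' \<longlonglongrightarrow> J"
    by (rule uniform_limit_integral) (auto intro!: continuous_on_mult cu G)
  have "I' = (\<lambda>n. \<Sum>m<n. f m * I m)"
  proof
    fix n
    have "((\<lambda>\<theta>. \<Sum>m<n. f m * (cis (p m * \<theta>) * G \<theta>)) has_integral (\<Sum>m<n. f m * I m)) {a..b}"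
      by (intro has_integral_sum has_integral_mult_right I) auto
    then show "I' n = (\<Sum>m<n. f m * I m)" using has_integral_unique[OF I'[of n]] by (simp add: sum_distrib_right mult.assoc)
  qed
  with lim have "(\<lambda>n. \<Sum>m<n. f m * I m) \<longlonglongrightarrow> J" by simp
  then have "J = S" using S unfolding sums_def by (rule LIMSEQ_unique)
  then show ?thesis using J by simp
qed

text \<open>Parseval's identity. The sign \<open>s\<close> is there because the square function estimate uses the frequencies
\<open>k\<close> and the dual one the frequencies \<open>-k\<close>.\<close>

lemma has_integral_norm_trig_poly:
  fixes c :: "nat \<Rightarrow> 'a::complex_hilbert_space"
  assumes s: "s = 1 \<or> s = (-1::int)"
  shows "((\<lambda>\<theta>. (norm (\<Sum>k<n. cis (of_int (s * int k) * \<theta>) *\<^sub>C c k))\<^sup>2)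
    has_integral 2 * pi * (\<Sum>k<n. (norm (c k))\<^sup>2)) {-pi..pi}"
proof -
  let ?e = "\<lambda>k \<theta>. cis (of_int (s * int k) * \<theta>)"
  have eq: "(norm (\<Sum>k<n. ?e k \<theta> *\<^sub>C c k))\<^sup>2
      = (\<Sum>k<n. \<Sum>l<n. Re (cis (of_int (s * (int k - int l)) * \<theta>) * cinner (c k) (c l)))" for \<theta>
  proof -
    have "inner (?e k \<theta> *\<^sub>C c k) (?e l \<theta> *\<^sub>C c l)
        = Re (cis (of_int (s * (int k - int l)) * \<theta>) * cinner (c k) (c l))" for k l
    proof -
      have "inner (?e k \<theta> *\<^sub>C c k) (?e l \<theta> *\<^sub>C c l) = inner ((cnj (?e l \<theta>) * ?e k \<theta>) *\<^sub>C c k) (c l)"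
        by (metis inner_scaleC_cnj scaleC_scaleC complex_cnj_cnj)
      also have "cnj (?e l \<theta>) * ?e k \<theta> = cis (of_int (s * (int k - int l)) * \<theta>)"
        by (simp add: cis_cnj cis_mult algebra_simps)
      finally show ?thesis by (simp add: inner_scaleC_left)
    qed
    then show ?thesis
      unfolding power2_norm_eq_inner inner_sum_left unfolding inner_sum_right by (simp only:)
  qed
  have "((\<lambda>\<theta>. Re (cis (of_int (s * (int k - int l)) * \<theta>) * cinner (c k) (c l)))
     has_integral (if l = k then 2 * pi * (norm (c k))\<^sup>2 else 0)) {-pi..pi}" for k l
  proof -
    have "((\<lambda>\<theta>. Re (cis (of_int (s * (int k - int l)) * \<theta>) * cinner (c k) (c l)))
     has_integral Re ((if s * (int k - int l) = 0 then 2 * of_real pi else 0) * cinner (c k) (c l))) {-pi..pi}"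
      by (intro has_integral_Re has_integral_mult_left has_integral_cis)
    then show ?thesis using s by (auto simp: Re_cinner power2_norm_eq_inner)
  qed
  then have "((\<lambda>\<theta>. \<Sum>k<n. \<Sum>l<n. Re (cis (of_int (s * (int k - int l)) * \<theta>) * cinner (c k) (c l)))
     has_integral (\<Sum>k<n. \<Sum>l<n. (if l = k then 2 * pi * (norm (c k))\<^sup>2 else 0))) {-pi..pi}"
    by (intro has_integral_sum) auto
  then show ?thesis unfolding eq by (simp add: sum_distrib_left)
qed

section \<open>The resolvent on the unit disc\<close>

text \<open>\<open>Q w\<close> is the inverse of \<open>1 - w T\<close> on the open unit disc. The variable \<open>w = 1 / \<lambda>\<close> is used in place of
\<open>\<lambda>\<close> because \<open>Q\<close> is then a power series, with the powers of \<open>T\<close> as coefficients.\<close>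

locale resolvent_family =
  fixes T :: "'a::complex_hilbert_space \<Rightarrow> 'a" and Q :: "complex \<Rightarrow> 'a \<Rightarrow> 'a" and C :: real
  assumes T: "bounded_clinear T"
    and Q: "\<And>w. cmod w < 1 \<Longrightarrow> bounded_clinear (Q w)"
    and Q_left: "\<And>w x. cmod w < 1 \<Longrightarrow> Q w (x - w *\<^sub>C T x) = x"
    and Q_right: "\<And>w x. cmod w < 1 \<Longrightarrow> Q w x - w *\<^sub>C T (Q w x) = x"
    and Q_norm: "\<And>w x. cmod w < 1 \<Longrightarrow> norm (Q w x) \<le> C / cmod (1 - w) * norm x"
    and C: "C \<ge> 0"
begin

lemma resolvent_identity:
  assumes "cmod v < 1" "cmod w < 1"
  shows "Q v x - Q w x = (v - w) *\<^sub>C Q v (T (Q w x))"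
proof -
  have "Q w x - v *\<^sub>C T (Q w x) = x - (v - w) *\<^sub>C T (Q w x)"
  proof -
    have "v *\<^sub>C T (Q w x) = w *\<^sub>C T (Q w x) + (v - w) *\<^sub>C T (Q w x)"
      by (simp flip: scaleC_add_left)
    then show ?thesis using Q_right[OF assms(2), of x] by (metis diff_diff_add)
  qed
  then have "Q w x = Q v x - (v - w) *\<^sub>C Q v (T (Q w x))"
    using Q_left[OF assms(1), of "Q w x"] bounded_clinearD[OF Q[OF assms(1)]] by simp
  then show ?thesis by (simp add: algebra_simps)
qed

lemma Q_tendsto:
  assumes w: "cmod w < 1" shows "((\<lambda>v. Q v x) \<longlongrightarrow> Q w x) (at w)"
proof -
  let ?z = "T (Q w x)"
  have "((\<lambda>v. Q v x - Q w x) \<longlongrightarrow> 0) (at w)"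
  proof (rule Lim_null_comparison)
    show "\<forall>\<^sub>F v in at w. norm (Q v x - Q w x) \<le> cmod (v - w) * (C / cmod (1 - v) * norm ?z)"
    proof -
      have "\<forall>\<^sub>F v in at w. v \<in> ball 0 1"
        using w by (intro eventually_at_in_open') auto
      then show ?thesis
      proof eventually_elim
        case (elim v)
        then have "norm (Q v ?z) \<le> C / cmod (1 - v) * norm ?z" "Q v x - Q w x = (v - w) *\<^sub>C Q v ?z"
          using Q_norm resolvent_identity[OF _ w] by auto
        then show ?case by (simp only: norm_scaleC mult_left_mono norm_ge_zero)
      qed
    qed
    have "((\<lambda>v. cmod (v - w) * (C / cmod (1 - v) * norm ?z)) \<longlongrightarrow> cmod (w - w) * (C / cmod (1 - w) * norm ?z)) (at w)"
      using w by (intro tendsto_intros) auto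
    then show "((\<lambda>v. cmod (v - w) * (C / cmod (1 - v) * norm ?z)) \<longlongrightarrow> 0) (at w)" by simp
  qed
  then show ?thesis by (rule LIM_zero_cancel)
qed

text \<open>By the resolvent identity the derivative is \<open>cinner (Q w (T (Q w x))) y\<close>.\<close>

lemma cinner_Q_holomorphic: "(\<lambda>w. cinner (Q w x) y) holomorphic_on ball 0 1"
  unfolding holomorphic_on_def
proof
  fix w :: complex assume "w \<in> ball 0 1"
  then have w: "cmod w < 1" by simp
  let ?z = "T (Q w x)"
  have "((\<lambda>v. cinner (Q v x) y) has_field_derivative cinner (Q w ?z) y) (at w)"
    unfolding has_field_derivative_iff
  proof (rule Lim_transform_eventually)
    show "((\<lambda>v. cinner (Q v ?z) y) \<longlongrightarrow> cinner (Q w ?z) y) (at w)"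
      by (intro bounded_linear.tendsto[OF bounded_linear_cinner_left] Q_tendsto w)
    have "\<forall>\<^sub>F v in at w. v \<in> ball 0 1" 
      using w by (intro eventually_at_in_open') auto
    moreover have "\<forall>\<^sub>F v in at w. v \<noteq> w"
      by (simp add: eventually_at_filter)
    ultimately show "\<forall>\<^sub>F v in at w. cinner (Q v ?z) y = (cinner (Q v x) y - cinner (Q w x) y) / (v - w)"
    proof eventually_elim
      case (elim v)
      have "cinner (Q v x) y - cinner (Q w x) y = cinner ((v - w) *\<^sub>C Q v ?z) y"
        using resolvent_identity[of v w x] w elim
          linear_diff[OF bounded_linear.linear[OF bounded_linear_cinner_left]] by (metis mem_ball_0)
      then show ?case using elim by (simp add: cinner_scaleC_left)
    qed
  qed
  then show "(\<lambda>w. cinner (Q w x) y) field_differentiable at w within ball 0 1"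
    using field_differentiable_at_within field_differentiable_def by blast
qed

lemma cinner_Q_partial_sum:
  assumes w: "cmod w < 1"
  shows "cinner (Q w x) y = (\<Sum>k<n. cinner ((T ^^ k) x) y * w ^ k) + w ^ n * cinner ((T ^^ n) (Q w x)) y"
proof (induction n)
  case (Suc n)
  have "(T ^^ n) (Q w x) = (T ^^ n) (x + w *\<^sub>C T (Q w x))"
    using Q_right[OF w, of x] by (metis diff_add_cancel)
  also have "\<dots> = (T ^^ n) x + w *\<^sub>C (T ^^ Suc n) (Q w x)"
    by (simp add: bounded_clinearD[OF bounded_clinear_funpow[OF T]] funpow_swap1)
  finally have "cinner ((T ^^ n) (Q w x)) y = cinner ((T ^^ n) x) y + w * cinner ((T ^^ Suc n) (Q w x)) y"
    by (simp only: cinner_add_left cinner_scaleC_left)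
  then show ?case
    unfolding Suc.IH by (simp add: algebra_simps del: funpow.simps)
qed simp

lemma cinner_Q_fps: "(\<lambda>w. cinner (Q w x) y) has_fps_expansion Abs_fps (\<lambda>n. cinner ((T ^^ n) x) y)"
proof (rule has_fps_expansionI)
  obtain K where K: "K > 0" "\<And>x. norm (T x) \<le> norm x * K"
    using bounded_linear.pos_bounded[OF bounded_clinearD(1)[OF T]] by blast
  have Tn: "norm ((T ^^ n) z) \<le> K ^ n * norm z" for n z
  proof (induction n)
    case (Suc n)
    have "norm ((T ^^ Suc n) z) \<le> K * norm ((T ^^ n) z)" using K(2) by (simp add: mult.commute)
    also have "\<dots> \<le> K * (K ^ n * norm z)" using Suc K(1) by (intro mult_left_mono) auto
    finally show ?case by (simp add: mult_ac)
  qed simp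
  have "\<forall>\<^sub>F w in nhds 0. w \<in> ball 0 (min 1 (1 / K))"
    using K by (intro eventually_nhds_in_open) auto
  then show "\<forall>\<^sub>F w in nhds 0. (\<lambda>n. fps_nth (Abs_fps (\<lambda>n. cinner ((T ^^ n) x) y)) n * w ^ n) sums cinner (Q w x) y"
  proof eventually_elim
    case (elim w)
    then have w: "cmod w < 1" "cmod w * K < 1" using K by (auto simp: field_simps)
    have "(\<lambda>n. w ^ n * cinner ((T ^^ n) (Q w x)) y) \<longlonglongrightarrow> 0"
    proof (rule Lim_null_comparison)
      show "\<forall>\<^sub>F n in sequentially. norm (w ^ n * cinner ((T ^^ n) (Q w x)) y)
          \<le> (cmod w * K) ^ n * (norm (Q w x) * norm y)"
      proof (intro always_eventually allI)
        fix n
        have "cmod (cinner ((T ^^ n) (Q w x)) y) \<le> (K ^ n * norm (Q w x)) * norm y"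
          using cmod_cinner_le[of "(T ^^ n) (Q w x)" y] mult_right_mono[OF Tn[of n "Q w x"] norm_ge_zero[of y]]
          by linarith
        then have "cmod w ^ n * cmod (cinner ((T ^^ n) (Q w x)) y) \<le> cmod w ^ n * ((K ^ n * norm (Q w x)) * norm y)"
          by (intro mult_left_mono) auto
        then show "norm (w ^ n * cinner ((T ^^ n) (Q w x)) y) \<le> (cmod w * K) ^ n * (norm (Q w x) * norm y)"
          by (simp add: norm_mult norm_power power_mult_distrib mult_ac)
      qed
      show "(\<lambda>n. (cmod w * K) ^ n * (norm (Q w x) * norm y)) \<longlonglongrightarrow> 0"
        using w K by (intro tendsto_mult_left_zero LIMSEQ_power_zero) auto
    qed
    then have "(\<lambda>n. cinner (Q w x) y - w ^ n * cinner ((T ^^ n) (Q w x)) y) \<longlonglongrightarrow> cinner (Q w x) y - 0"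
      by (intro tendsto_diff tendsto_const)
    moreover have "cinner (Q w x) y - w ^ n * cinner ((T ^^ n) (Q w x)) y
        = (\<Sum>k<n. cinner ((T ^^ k) x) y * w ^ k)" for n
      using cinner_Q_partial_sum[OF w(1), of x y n] by simp
    ultimately show ?case by (simp add: sums_def)
  qed
qed

text \<open>Near zero the Neumann series gives the expansion; it persists on the whole disc because the
function is holomorphic there. The growth of \<open>T\<^sup>n\<close> is thereby controlled.\<close>

lemma cinner_Q_sums:
  assumes w: "cmod w < 1"
  shows "summable (\<lambda>n. norm (cinner ((T ^^ n) x) y * w ^ n))"
    and "(\<lambda>n. cinner ((T ^^ n) x) y * w ^ n) sums cinner (Q w x) y"
proof -
  let ?F = "Abs_fps (\<lambda>n. cinner ((T ^^ n) x) y)"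
  have "fps_conv_radius ?F \<ge> 1"
    by (rule holomorphic_on_imp_fps_conv_radius_ge[OF cinner_Q_fps])
       (use cinner_Q_holomorphic in \<open>simp add: one_ereal_def\<close>)
  then have r: "ereal (cmod w) < fps_conv_radius ?F"
    using w by (intro less_le_trans[OF _ \<open>fps_conv_radius ?F \<ge> 1\<close>]) simp
  show "summable (\<lambda>n. norm (cinner ((T ^^ n) x) y * w ^ n))"
    using abs_summable_in_conv_radius[of w "fps_nth ?F"] r by (simp add: fps_conv_radius_def)
  have "eval_fps ?F w = cinner (Q w x) y"
    by (rule has_fps_expansion_imp_eval_fps_eq[OF cinner_Q_fps w cinner_Q_holomorphic])
  then show "(\<lambda>n. cinner ((T ^^ n) x) y * w ^ n) sums cinner (Q w x) y"
    using sums_eval_fps[OF r] by simp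
qed

end

section \<open>Fourier coefficients of the resolvent\<close>

lemma cmod_one_minus_ge: "0 \<le> t \<Longrightarrow> 1 - t \<le> cmod (1 - of_real t * cis \<theta>)"
  using norm_triangle_ineq2[of 1 "of_real t * cis \<theta>"] by (simp add: norm_mult)

text \<open>The two points \<open>e\<^sup>i\<^sup>\<theta>\<close> and \<open>t e\<^sup>i\<^sup>\<theta>\<close> are at distance \<open>1 - t\<close>, which is at most \<open>\<bar>1 - t e\<^sup>i\<^sup>\<theta>\<bar>\<close>.\<close>

lemma cmod_one_minus_cis_le:
  assumes "0 \<le> t" "t \<le> 1"
  shows "cmod (1 - cis \<theta>) \<le> 2 * cmod (1 - of_real t * cis \<theta>)"
proof -
  let ?w = "of_real t * cis \<theta>"
  have "?w - cis \<theta> = of_real (t - 1) * cis \<theta>" by (simp add: algebra_simps)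
  then have "cmod (?w - cis \<theta>) = 1 - t"
    using assms by (simp only: norm_mult norm_of_real norm_cis) simp
  moreover have "cmod (1 - cis \<theta>) \<le> cmod (1 - ?w) + cmod (?w - cis \<theta>)"
    using norm_triangle_ineq[of "1 - ?w" "?w - cis \<theta>"] by simp
  ultimately show ?thesis using cmod_one_minus_ge[of t \<theta>] assms by linarith
qed

context resolvent_family
begin

lemma cinner_Q_trig_series:
  assumes t: "0 \<le> t" "t < 1"
  shows "cinner (Q (of_real t * cis \<theta>) x) y
      = (\<Sum>m. (cinner ((T ^^ m) x) y * of_real t ^ m) * cis (real m * \<theta>))"
    and "summable (\<lambda>m. norm (cinner ((T ^^ m) x) y * of_real t ^ m))"
proof -
  have w: "cmod (of_real t * cis \<theta>) < 1" using t by (simp add: norm_mult)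
  show "cinner (Q (of_real t * cis \<theta>) x) y
      = (\<Sum>m. (cinner ((T ^^ m) x) y * of_real t ^ m) * cis (real m * \<theta>))"
    using sums_unique[OF cinner_Q_sums(2)[OF w, of x y]]
    by (simp add: power_mult_distrib Complex.DeMoivre mult.assoc)
  show "summable (\<lambda>m. norm (cinner ((T ^^ m) x) y * of_real t ^ m))"
    using cinner_Q_sums(1)[of "of_real t" x y] t by simp
qed

lemma continuous_on_cinner_Q:
  assumes t: "0 \<le> t" "t < 1"
  shows "continuous_on A (\<lambda>\<theta>. cinner (Q (of_real t * cis \<theta>) x) y)"
proof -
  have "continuous_on A ((\<lambda>w. cinner (Q w x) y) \<circ> (\<lambda>\<theta>. of_real t * cis \<theta>))"
    by (rule continuous_on_compose)
       (use t in \<open>auto simp: norm_mult intro!: continuous_intros continuous_on_cis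
         continuous_on_subset[OF holomorphic_on_imp_continuous_on[OF cinner_Q_holomorphic]]\<close>)
  then show ?thesis by (simp add: o_def)
qed

lemma has_integral_cis_cinner_Q:
  assumes t: "0 \<le> t" "t < 1"
  shows "((\<lambda>\<theta>. cis (of_int q * \<theta>) * cinner (Q (of_real t * cis \<theta>) x) y) has_integral
     (if q \<le> 0 then 2 * of_real pi * of_real t ^ nat (- q) * cinner ((T ^^ nat (- q)) x) y else 0)) {-pi..pi}"
proof -
  let ?f = "\<lambda>m. cinner ((T ^^ m) x) y * of_real t ^ m"
  have "((\<lambda>\<theta>. (\<Sum>m. ?f m * cis (real m * \<theta>)) * cis (of_int q * \<theta>)) has_integral
     (if q \<le> 0 then 2 * of_real pi * of_real t ^ nat (- q) * cinner ((T ^^ nat (- q)) x) y else 0)) {-pi..pi}"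
  proof (rule has_integral_trig_series_mult[OF cinner_Q_trig_series(2)[OF t]])
    show "((\<lambda>\<theta>. cis (real m * \<theta>) * cis (of_int q * \<theta>)) has_integral (if int m + q = 0 then 2 * of_real pi else 0)) {-pi..pi}" for m
      using has_integral_cis[of "int m + q"] by (simp add: cis_mult algebra_simps)
    show "(\<lambda>m. ?f m * (if int m + q = 0 then 2 * of_real pi else 0)) sums
       (if q \<le> 0 then 2 * of_real pi * of_real t ^ nat (- q) * cinner ((T ^^ nat (- q)) x) y else 0)"
    proof (cases "q \<le> 0")
      case True
      have "(\<lambda>m. ?f m * (if int m + q = 0 then 2 * of_real pi else 0)) sums
          (\<Sum>m\<in>{nat (- q)}. ?f m * (if int m + q = 0 then 2 * of_real pi else 0))"
        by (rule sums_finite) auto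
      then show ?thesis using True by (simp add: mult_ac)
    next
      case False
      then have "int m + q \<noteq> 0" for m by linarith
      then show ?thesis using False by simp
    qed
  qed (intro continuous_intros continuous_on_cis)
  then show ?thesis by (simp only: cinner_Q_trig_series(1)[OF t] mult.commute[of "cis (of_int q * _)"])
qed

lemma funpow_scaleR_T: "((\<lambda>x. t *\<^sub>R T x) ^^ n) x = t ^ n *\<^sub>R (T ^^ n) x"
  by (induction n) (simp_all add: bounded_clinearD[OF T])

text \<open>Cauchy's estimate: \<open>t\<^sup>n T\<^sup>n\<close> is a Fourier coefficient of \<open>Q (t e\<^sup>i\<^sup>\<theta>)\<close>. The constant explodes as \<open>t\<close>
tends to \<open>1\<close>; it only serves to make the series of \<open>(1 - t T)\<^sup>1\<^sup>/\<^sup>2\<close> converge.\<close>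

lemma power_bounded_scaled:
  assumes t: "0 \<le> t" "t < 1"
  shows "power_bounded_by (C / (1 - t)) (\<lambda>x. t *\<^sub>R T x)"
  unfolding power_bounded_by_def
proof (intro conjI allI)
  fix n and x :: 'a
  let ?y = "(T ^^ n) x" and ?I = "2 * of_real pi * of_real t ^ n * cinner ((T ^^ n) x) ((T ^^ n) x)"
  have "norm ?I \<le> (C / (1 - t) * norm x * norm ?y) * measure lborel {-pi..pi}"
  proof (rule has_integral_bound_real[where S="{}"])
    show "((\<lambda>\<theta>. cis (of_int (- int n) * \<theta>) * cinner (Q (of_real t * cis \<theta>) x) ?y) has_integral ?I) {-pi..pi}"
      using has_integral_cis_cinner_Q[OF t, of "- int n" x ?y] by simp
    show "finite ({} :: real set)" by simp
    show "0 \<le> C / (1 - t) * norm x * norm ?y" using t C by simp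
    fix \<theta>
    have "norm (Q (of_real t * cis \<theta>) x) \<le> C / cmod (1 - of_real t * cis \<theta>) * norm x"
      using Q_norm[of "of_real t * cis \<theta>"] t by (simp add: norm_mult)
    also have "\<dots> \<le> C / (1 - t) * norm x"
    proof -
      have "0 < cmod (1 - of_real t * cis \<theta>)" using t cmod_one_minus_ge[of t \<theta>] by linarith
      then show ?thesis
        using t C cmod_one_minus_ge[of t \<theta>]
        by (intro mult_right_mono divide_left_mono mult_pos_pos) auto
    qed
    finally have "norm (Q (of_real t * cis \<theta>) x) * norm ?y \<le> C / (1 - t) * norm x * norm ?y"
      by (intro mult_right_mono) auto
    then show "norm (cis (of_int (- int n) * \<theta>) * cinner (Q (of_real t * cis \<theta>) x) ?y) \<le> C / (1 - t) * norm x * norm ?y"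
      using cmod_cinner_le[of "Q (of_real t * cis \<theta>) x" ?y] by (simp add: norm_mult)
  qed
  moreover have "cmod (cinner ?y ?y) \<ge> (norm ?y)\<^sup>2"
    using complex_Re_le_cmod[of "cinner ?y ?y"] by (simp add: Re_cinner power2_norm_eq_inner)
  then have "2 * pi * t ^ n * (norm ?y)\<^sup>2 \<le> norm ?I"
    using t by (simp add: norm_mult norm_power mult_left_mono)
  ultimately have "2 * pi * (t ^ n * norm ?y * norm ?y) \<le> 2 * pi * (C / (1 - t) * norm x * norm ?y)"
    by (simp add: power2_eq_square mult_ac)
  then have "t ^ n * norm ?y * norm ?y \<le> C / (1 - t) * norm x * norm ?y"
    by (rule mult_left_le_imp_le) simp
  then have "t ^ n * norm ?y \<le> C / (1 - t) * norm x"
  proof (cases "?y = 0")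
    case False
    then have "0 < norm ?y" by simp
    with \<open>t ^ n * norm ?y * norm ?y \<le> C / (1 - t) * norm x * norm ?y\<close> show ?thesis
      by (rule mult_right_le_imp_le)
  qed (use t C in simp)
  then show "norm (((\<lambda>x. t *\<^sub>R T x) ^^ n) x) \<le> C / (1 - t) * norm x"
    using t by (simp add: funpow_scaleR_T)
qed (rule bounded_clinear_scaleR[OF T])

lemma csqrt_series_cis: "csqrt_series (cis (- \<theta>)) = (\<Sum>j. of_real (sqrt_coeff j) * cis (- real j * \<theta>))"
  by (simp add: csqrt_series_def Complex.DeMoivre)

definition defect_power :: "real \<Rightarrow> nat \<Rightarrow> 'a \<Rightarrow> 'a" where
  "defect_power t k x = ((\<lambda>x. t *\<^sub>R T x) ^^ k) (sqrt_one_minus (\<lambda>x. t *\<^sub>R T x) x)"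

text \<open>The factor \<open>(1 - e\<^sup>-\<^sup>i\<^sup>\<theta>)\<^sup>1\<^sup>/\<^sup>2 e\<^sup>-\<^sup>i\<^sup>k\<^sup>\<theta>\<close> only contains frequencies \<open>-k, -k-1, \<dots>\<close>. Against \<open>Q\<close>, which has
the nonnegative frequencies, it therefore produces
\<open>\<Sum>\<^sub>j a\<^sub>j (t T)\<^sup>j\<^sup>+\<^sup>k x = (t T)\<^sup>k (1 - t T)\<^sup>1\<^sup>/\<^sup>2 x\<close>. The adjoint of \<open>Q\<close> has the nonpositive frequencies and
contributes only its constant term, and this for \<open>k = 0\<close> only.\<close>

lemma has_integral_square_function_kernel:
  assumes t: "0 \<le> t" "t < 1"
  shows "((\<lambda>\<theta>. inner ((csqrt_series (cis (- \<theta>)) * cis (- real k * \<theta>)) *\<^sub>C Q (of_real t * cis \<theta>) x) y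
       + inner ((csqrt_series (cis (- \<theta>)) * cis (- real k * \<theta>)) *\<^sub>C x) (Q (of_real t * cis \<theta>) y))
     has_integral 2 * pi * (inner (defect_power t k x) y + (if k = 0 then inner x y else 0))) {-pi..pi}"
proof -
  let ?X = "\<lambda>x. t *\<^sub>R T x"
  note pb = power_bounded_scaled[OF t]
  let ?F = "\<lambda>x y \<theta>. cinner (Q (of_real t * cis \<theta>) x) y"
  let ?G = "\<lambda>\<theta>. cis (- real k * \<theta>) * (?F x y \<theta> + cnj (?F y x \<theta>))"
  let ?I = "\<lambda>j. 2 * of_real pi * (cinner ((?X ^^ k) ((?X ^^ j) x)) y + (if j + k = 0 then cinner x y else 0))"
  let ?S = "2 * of_real pi * (cinner (defect_power t k x) y + (if k = 0 then cinner x y else 0))"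
  have "((\<lambda>\<theta>. (\<Sum>j. of_real (sqrt_coeff j) * cis (- real j * \<theta>)) * ?G \<theta>) has_integral ?S) {-pi..pi}"
  proof (rule has_integral_trig_series_mult)
    show "summable (\<lambda>j. norm (complex_of_real (sqrt_coeff j)))"
      using summable_abs_sqrt_coeff by simp
    show "continuous_on {-pi..pi} ?G"
      by (intro continuous_intros continuous_on_cis continuous_on_cinner_Q[OF t])
    show "((\<lambda>\<theta>. cis (- real j * \<theta>) * ?G \<theta>) has_integral ?I j) {-pi..pi}" for j
    proof -
      have "((\<lambda>\<theta>. cis (of_int (- int (j + k)) * \<theta>) * ?F x y \<theta>) has_integral
          2 * of_real pi * of_real t ^ (j + k) * cinner ((T ^^ (j + k)) x) y) {-pi..pi}"
        using has_integral_cis_cinner_Q[OF t, of "- int (j + k)" x y]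
        by (simp only: neg_le_0_iff_le of_nat_0_le_iff minus_minus nat_int if_True)
      moreover have "((\<lambda>\<theta>. cnj (cis (of_int (int (j + k)) * \<theta>) * ?F y x \<theta>)) has_integral
          cnj (if j + k = 0 then 2 * of_real pi * cinner y x else 0)) {-pi..pi}"
      proof -
        have "((\<lambda>\<theta>. cis (of_int (int (j + k)) * \<theta>) * ?F y x \<theta>) has_integral
            (if j + k = 0 then 2 * of_real pi * cinner y x else 0)) {-pi..pi}"
          using has_integral_cis_cinner_Q[OF t, of "int (j + k)" y x] by (cases "j + k = 0") auto
        then have "(cnj \<circ> (\<lambda>\<theta>. cis (of_int (int (j + k)) * \<theta>) * ?F y x \<theta>) has_integral
            cnj (if j + k = 0 then 2 * of_real pi * cinner y x else 0)) {-pi..pi}"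
          by (simp only: has_integral_cnj)
        then show ?thesis by (simp only: o_def)
      qed
      ultimately have "((\<lambda>\<theta>. cis (of_int (- int (j + k)) * \<theta>) * ?F x y \<theta> + cnj (cis (of_int (int (j + k)) * \<theta>) * ?F y x \<theta>))
          has_integral (2 * of_real pi * of_real t ^ (j + k) * cinner ((T ^^ (j + k)) x) y
            + cnj (if j + k = 0 then 2 * of_real pi * cinner y x else 0))) {-pi..pi}"
        by (rule has_integral_add)
      moreover have "cis (of_int (- int (j + k)) * \<theta>) * ?F x y \<theta> + cnj (cis (of_int (int (j + k)) * \<theta>) * ?F y x \<theta>)
          = cis (- real j * \<theta>) * ?G \<theta>" for \<theta>
      proof -
        have "cis (of_int (- int (j + k)) * \<theta>) = cis (- real j * \<theta>) * cis (- real k * \<theta>)"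
          by (simp add: cis_mult algebra_simps)
        moreover have "cnj (cis (of_int (int (j + k)) * \<theta>)) = cis (- real j * \<theta>) * cis (- real k * \<theta>)"
          by (simp add: cis_mult cis_cnj algebra_simps)
        ultimately show ?thesis by (simp only: complex_cnj_mult distrib_left mult.assoc)
      qed
      moreover have "2 * of_real pi * of_real t ^ (j + k) * cinner ((T ^^ (j + k)) x) y
            + cnj (if j + k = 0 then 2 * of_real pi * cinner y x else 0) = ?I j"
      proof -
        have "(?X ^^ k) ((?X ^^ j) x) = (?X ^^ (j + k)) x"
          by (metis add.commute comp_apply funpow_add)
        also have "\<dots> = of_real (t ^ (j + k)) *\<^sub>C (T ^^ (j + k)) x"
          by (simp only: funpow_scaleR_T scaleC_of_real)
        finally have "cinner ((?X ^^ k) ((?X ^^ j) x)) y = of_real t ^ (j + k) * cinner ((T ^^ (j + k)) x) y"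
          by (simp only: cinner_scaleC_left of_real_power)
        moreover have "cnj (cinner y x) = cinner x y" by (metis cinner_commute)
        ultimately show ?thesis by (simp add: algebra_simps)
      qed
      ultimately show ?thesis by simp
    qed
    have kX: "bounded_linear (?X ^^ k)"
      by (rule bounded_clinearD(1)[OF bounded_clinear_funpow[OF bounded_clinear_scaleR[OF T]]])
    have "(\<lambda>j. cinner ((?X ^^ k) (sqrt_coeff j *\<^sub>R (?X ^^ j) x)) y) sums cinner (defect_power t k x) y"
      unfolding defect_power_def
      by (intro bounded_linear.sums[OF bounded_linear_cinner_left] bounded_linear.sums[OF kX] sums_sqrt_one_minus[OF pb])
    then have "(\<lambda>j. of_real (sqrt_coeff j) * cinner ((?X ^^ k) ((?X ^^ j) x)) y) sums cinner (defect_power t k x) y"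
      by (simp add: linear_scale[OF bounded_linear.linear[OF kX]]
          linear_scale[OF bounded_linear.linear[OF bounded_linear_cinner_left]] scaleR_conv_of_real)
    moreover have "(\<lambda>j. of_real (sqrt_coeff j) * (if j + k = 0 then cinner x y else 0)) sums (if k = 0 then cinner x y else 0)"
    proof -
      have "(\<lambda>j. of_real (sqrt_coeff j) * (if j + k = 0 then cinner x y else 0)) sums
          (\<Sum>j\<in>{0}. of_real (sqrt_coeff j) * (if j + k = 0 then cinner x y else 0))"
        by (rule sums_finite) auto
      then show ?thesis by simp
    qed
    ultimately have "(\<lambda>j. of_real (sqrt_coeff j) * cinner ((?X ^^ k) ((?X ^^ j) x)) y
        + of_real (sqrt_coeff j) * (if j + k = 0 then cinner x y else 0)) sums
        (cinner (defect_power t k x) y + (if k = 0 then cinner x y else 0))"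
      by (rule sums_add)
    from sums_mult[OF this, of "2 * of_real pi"]
    show "(\<lambda>j. of_real (sqrt_coeff j) * ?I j) sums ?S"
      by (rule back_subst[of "\<lambda>f. f sums _"]) (simp add: fun_eq_iff algebra_simps)
  qed
  then have "((\<lambda>\<theta>. Re (csqrt_series (cis (- \<theta>)) * ?G \<theta>)) has_integral Re ?S) {-pi..pi}"
    unfolding csqrt_series_cis by (rule has_integral_Re)
  moreover have "Re ?S = 2 * pi * (inner (defect_power t k x) y + (if k = 0 then inner x y else 0))"
    by (simp add: Re_cinner)
  moreover have "Re (csqrt_series (cis (- \<theta>)) * ?G \<theta>)
     = inner ((csqrt_series (cis (- \<theta>)) * cis (- real k * \<theta>)) *\<^sub>C Q (of_real t * cis \<theta>) x) y
       + inner ((csqrt_series (cis (- \<theta>)) * cis (- real k * \<theta>)) *\<^sub>C x) (Q (of_real t * cis \<theta>) y)" for \<theta>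
  proof -
    have "cnj (?F y x \<theta>) = cinner x (Q (of_real t * cis \<theta>) y)" by (metis cinner_commute)
    then show ?thesis
      unfolding inner_scaleC_left by (simp only: distrib_left mult.assoc plus_complex.sel)
  qed
  ultimately show ?thesis by simp
qed

end

section \<open>Square function estimates\<close>

text \<open>With \<open>g = min h R\<close> the quadratic form \<open>Re \<langle>A v, v\<rangle> + g \<parallel>v\<parallel>\<^sup>2\<close> is nonnegative; expand it at
\<open>v = x - \<beta> u\<close>. Of the two bounds for \<open>g\<close>, the one by \<open>h\<close> is used for the terms in \<open>x\<close>, since \<open>h\<close> will be
integrable, and the one by \<open>R\<close> for the terms in \<open>u\<close>, since there the factor \<open>\<bar>\<beta>\<bar>\<^sup>2\<close> compensates the
size of \<open>R\<close>. The left-hand side is the pairing of \<open>2 Re A\<close> with \<open>x\<close> and \<open>\<beta> u\<close>.\<close>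

lemma accretive_form_bound:
  fixes A :: "'a::complex_hilbert_space \<Rightarrow> 'a"
  assumes A: "bounded_clinear A" and R: "\<And>x. norm (A x) \<le> R * norm x"
    and h: "0 \<le> h" and pos: "\<And>x. - (h * (norm x)\<^sup>2) \<le> inner (A x) x" and R0: "0 \<le> R"
    and b: "R * (cmod \<beta>)\<^sup>2 \<le> B"
  shows "inner (A x) (\<beta> *\<^sub>C u) + inner x (A (\<beta> *\<^sub>C u)) \<le> inner (A x) x + 2 * h * (norm x)\<^sup>2 + 3 * B * (norm u)\<^sup>2"
proof -
  define g where "g = min h R"
  define v where "v = \<beta> *\<^sub>C u"
  have AR: "\<bar>inner (A x) x\<bar> \<le> R * (norm x)\<^sup>2" for x
  proof -
    have "\<bar>inner (A x) x\<bar> \<le> norm (A x) * norm x" by (rule Cauchy_Schwarz_ineq2)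
    also have "\<dots> \<le> (R * norm x) * norm x" by (intro mult_right_mono R) auto
    finally show ?thesis by (simp add: power2_eq_square)
  qed
  have g: "- (g * (norm x)\<^sup>2) \<le> inner (A x) x" for x
    using pos[of x] AR[of x] by (auto simp: g_def min_def)
  have v: "R * (norm v)\<^sup>2 \<le> B * (norm u)\<^sup>2"
    using mult_right_mono[OF b, of "(norm u)\<^sup>2"] by (simp add: v_def power_mult_distrib mult_ac)
  have "(norm (x - v))\<^sup>2 \<le> 2 * (norm x)\<^sup>2 + 2 * (norm v)\<^sup>2"
  proof -
    have "0 \<le> (norm (x + v))\<^sup>2" by simp
    then show ?thesis by (simp add: power2_norm_eq_inner inner_diff inner_add inner_commute)
  qed
  then have "g * (norm (x - v))\<^sup>2 \<le> g * (2 * (norm x)\<^sup>2 + 2 * (norm v)\<^sup>2)"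
    using h R0 by (intro mult_left_mono) (auto simp: g_def)
  also have "\<dots> \<le> 2 * h * (norm x)\<^sup>2 + 2 * (B * (norm u)\<^sup>2)"
  proof -
    have "g * (norm x)\<^sup>2 \<le> h * (norm x)\<^sup>2" "g * (norm v)\<^sup>2 \<le> R * (norm v)\<^sup>2"
      by (auto simp: g_def intro!: mult_right_mono)
    then show ?thesis using v by (simp add: algebra_simps)
  qed
  finally have "- (2 * h * (norm x)\<^sup>2 + 2 * (B * (norm u)\<^sup>2)) \<le> inner (A (x - v)) (x - v)"
    using g[of "x - v"] by linarith
  also have "\<dots> = inner (A x) x - (inner (A x) v + inner x (A v)) + inner (A v) v"
    by (simp add: bounded_clinearD[OF A] inner_diff inner_commute)
  also have "inner (A v) v \<le> B * (norm u)\<^sup>2" using AR[of v] v by linarith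
  finally show ?thesis by (simp add: v_def)
qed

text \<open>The lower bound for the resolvent says nothing at \<open>\<theta> = 0\<close>, hence the exceptional point.\<close>

lemma has_integral_le_except_point:
  fixes f g :: "real \<Rightarrow> real"
  assumes f: "(f has_integral I) S" and g: "(g has_integral J) S"
    and le: "\<And>x. x \<in> S \<Longrightarrow> x \<noteq> p \<Longrightarrow> f x \<le> g x"
  shows "I \<le> J"
proof (rule has_integral_le[OF f])
  show "((\<lambda>x. if x = p then f p else g x) has_integral J) S"
    by (rule has_integral_spike_finite[OF _ _ g, of "{p}"]) auto
qed (use le in auto)

text \<open>The hypothesis is the form that a pairing inequality takes when it is tested with \<open>e\<close> times the
extremal vector. The choice \<open>e = 1 / (2 k)\<close> lets the last term be absorbed on the left.\<close>

lemma quadratic_sqrt_bound: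
  fixes a b k :: real
  assumes "k > 0" "a \<ge> 0" and le: "\<And>e. e > 0 \<Longrightarrow> e * a \<le> k * (b + e\<^sup>2 * a)"
  shows "a \<le> 4 * k\<^sup>2 * b"
proof -
  have "1 / (2 * k) * a \<le> k * (b + (1 / (2 * k))\<^sup>2 * a)"
    using assms by (intro le) auto
  then show ?thesis using assms(1) by (simp add: field_simps power2_eq_square)
qed

context resolvent_family
begin

context
  fixes t :: real and h :: "real \<Rightarrow> real" and H :: real
  assumes t: "0 \<le> t" "t < 1"
    and h: "(h has_integral H) {-pi..pi}"
    and h_nonneg: "\<And>\<theta>. \<theta> \<in> {-pi..pi} \<Longrightarrow> 0 \<le> h \<theta>"
    and pos: "\<And>\<theta> x. \<theta> \<in> {-pi..pi} \<Longrightarrow> \<theta> \<noteq> 0 \<Longrightarrow>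
        - (h \<theta> * (norm x)\<^sup>2) \<le> inner (Q (of_real t * cis \<theta>) x) x"
begin

lemma H_nonneg: "0 \<le> H"
  using has_integral_nonneg[OF h h_nonneg] .

text \<open>Here \<open>\<bar>\<beta>\<bar>\<^sup>2 = \<bar>1 - e\<^sup>i\<^sup>\<theta>\<bar> \<le> 2 \<bar>1 - t e\<^sup>i\<^sup>\<theta>\<bar>\<close> cancels the singularity of the Ritt bound at \<open>\<theta> = 0\<close>, so that the
coefficient of \<open>\<parallel>u\<parallel>\<^sup>2\<close> is bounded in \<open>\<theta>\<close> and \<open>t\<close>.\<close>

lemma resolvent_form_bound:
  assumes th: "\<theta> \<in> {-pi..pi}" "\<theta> \<noteq> 0" and b: "cmod \<beta> = cmod (csqrt_series (cis (- \<theta>)))"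
  shows "inner (Q (of_real t * cis \<theta>) x) (\<beta> *\<^sub>C u) + inner x (Q (of_real t * cis \<theta>) (\<beta> *\<^sub>C u))
    \<le> inner (Q (of_real t * cis \<theta>) x) x + 2 * h \<theta> * (norm x)\<^sup>2 + 6 * C * (norm u)\<^sup>2"
proof -
  let ?w = "of_real t * cis \<theta>"
  have w: "cmod ?w < 1" using t by (simp add: norm_mult)
  have k: "0 < cmod (1 - ?w)" using cmod_one_minus_ge[of t \<theta>] t by linarith
  have "(cmod \<beta>)\<^sup>2 = cmod (1 - cis (- \<theta>))"
    unfolding b by (rule norm_csqrt_series_squared) simp
  also have "\<dots> = cmod (1 - cis \<theta>)"
    by (metis cis_cnj complex_cnj_diff complex_cnj_one complex_mod_cnj)
  also have "\<dots> \<le> 2 * cmod (1 - ?w)"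
    using t by (intro cmod_one_minus_cis_le) auto
  finally have "C / cmod (1 - ?w) * (cmod \<beta>)\<^sup>2 \<le> C / cmod (1 - ?w) * (2 * cmod (1 - ?w))"
    using C by (intro mult_left_mono) auto
  also have "\<dots> = 2 * C" using k by simp
  finally have "inner (Q ?w x) (\<beta> *\<^sub>C u) + inner x (Q ?w (\<beta> *\<^sub>C u))
    \<le> inner (Q ?w x) x + 2 * h \<theta> * (norm x)\<^sup>2 + 3 * (2 * C) * (norm u)\<^sup>2"
    by (intro accretive_form_bound[OF Q[OF w] Q_norm[OF w] h_nonneg pos]) (use th C in auto)
  then show ?thesis by simp
qed

lemma has_integral_majorant:
  assumes s: "s = 1 \<or> s = (-1::int)"
  shows "((\<lambda>\<theta>. inner (Q (of_real t * cis \<theta>) x) x + 2 * h \<theta> * (norm x)\<^sup>2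
      + 6 * C * (norm (\<Sum>k<n. cis (of_int (s * int k) * \<theta>) *\<^sub>C c k))\<^sup>2)
    has_integral 2 * pi * (norm x)\<^sup>2 + 2 * H * (norm x)\<^sup>2 + 6 * C * (2 * pi * (\<Sum>k<n. (norm (c k))\<^sup>2))) {-pi..pi}"
proof (intro has_integral_add has_integral_mult_right has_integral_mult_left h has_integral_norm_trig_poly s)
  have "((\<lambda>\<theta>. Re (cis (of_int 0 * \<theta>) * cinner (Q (of_real t * cis \<theta>) x) x)) has_integral
      Re (2 * of_real pi * of_real t ^ 0 * cinner ((T ^^ 0) x) x)) {-pi..pi}"
    using has_integral_cis_cinner_Q[OF t, of 0 x x] by (intro has_integral_Re) simp
  then show "((\<lambda>\<theta>. inner (Q (of_real t * cis \<theta>) x) x) has_integral 2 * pi * (norm x)\<^sup>2) {-pi..pi}"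
    by (simp add: Re_cinner power2_norm_eq_inner)
qed

text \<open>The term with \<open>c 0\<close> stems from the constant Fourier coefficient of the adjoint of \<open>Q\<close>. It is absorbed
into the right-hand side at the cost of increasing the constant by one.\<close>

lemma pairing_bound_from_integrals:
  fixes c :: "nat \<Rightarrow> 'a"
  assumes "2 * pi * (X + (if 0 < n then inner x (c 0) else 0))
      \<le> 2 * pi * (norm x)\<^sup>2 + 2 * H * (norm x)\<^sup>2 + 6 * C * (2 * pi * (\<Sum>k<n. (norm (c k))\<^sup>2))"
  shows "X \<le> (2 + H / pi + 6 * C) * ((norm x)\<^sup>2 + (\<Sum>k<n. (norm (c k))\<^sup>2))"
proof -
  let ?c = "\<Sum>k<n. (norm (c k))\<^sup>2"
  have c: "0 \<le> ?c" by (intro sum_nonneg) simp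
  have "X + (if 0 < n then inner x (c 0) else 0) \<le> (norm x)\<^sup>2 + H / pi * (norm x)\<^sup>2 + 6 * C * ?c"
    using assms by (simp add: field_simps)
  moreover have "- (if 0 < n then inner x (c 0) else 0) \<le> (norm x)\<^sup>2 + ?c"
  proof (cases "0 < n")
    case True
    then have "(norm (c 0))\<^sup>2 \<le> ?c"
      using member_le_sum[of 0 "{..<n}" "\<lambda>k. (norm (c k))\<^sup>2"] by simp
    moreover have "0 \<le> (norm (x + c 0))\<^sup>2" by simp
    then have "- (2 * inner x (c 0)) \<le> (norm x)\<^sup>2 + (norm (c 0))\<^sup>2"
      by (simp add: power2_norm_eq_inner inner_add inner_commute)
    ultimately have "- inner x (c 0) \<le> (norm x)\<^sup>2 + ?c" using c zero_le_power2[of "norm x"] by linarith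
    then show ?thesis using True by simp
  qed (use c in auto)
  moreover have "0 \<le> H / pi * ?c" "0 \<le> 6 * C * (norm x)\<^sup>2" using c C H_nonneg by auto
  ultimately show ?thesis using c by (simp add: algebra_simps)
qed

text \<open>Integrate \<open>resolvent_form_bound\<close> with \<open>\<beta> u = cnj b \<cdot> \<Sum>\<^sub>k e\<^sup>i\<^sup>k\<^sup>\<theta> c\<^sub>k\<close>.\<close>

lemma sum_defect_power_pairing_le:
  "(\<Sum>k<n. inner (defect_power t k x) (c k)) \<le> (2 + H / pi + 6 * C) * ((norm x)\<^sup>2 + (\<Sum>k<n. (norm (c k))\<^sup>2))"
proof (rule pairing_bound_from_integrals)
  let ?w = "\<lambda>\<theta>. of_real t * cis \<theta>" and ?b = "\<lambda>\<theta>. csqrt_series (cis (- \<theta>))"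
  let ?u = "\<lambda>\<theta>. \<Sum>k<n. cis (of_int (1 * int k) * \<theta>) *\<^sub>C c k"
  let ?E = "\<lambda>\<theta>. inner (Q (?w \<theta>) x) (cnj (?b \<theta>) *\<^sub>C ?u \<theta>) + inner x (Q (?w \<theta>) (cnj (?b \<theta>) *\<^sub>C ?u \<theta>))"
  have E: "?E \<theta> = (\<Sum>k<n. inner ((?b \<theta> * cis (- real k * \<theta>)) *\<^sub>C Q (?w \<theta>) x) (c k)
       + inner ((?b \<theta> * cis (- real k * \<theta>)) *\<^sub>C x) (Q (?w \<theta>) (c k)))" for \<theta>
  proof -
    have w: "cmod (?w \<theta>) < 1" using t by (simp add: norm_mult)
    have u: "cnj (?b \<theta>) *\<^sub>C ?u \<theta> = (\<Sum>k<n. cnj (?b \<theta> * cis (- real k * \<theta>)) *\<^sub>C c k)"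
      by (simp add: linear_sum[OF bounded_linear.linear[OF bounded_linear_scaleC]] scaleC_scaleC cis_cnj)
    show ?thesis
      unfolding u by (simp add: bounded_clinearD(4,7)[OF Q[OF w]] inner_sum_right sum.distrib inner_scaleC_cnj)
  qed
  have "(?E has_integral (\<Sum>k<n. 2 * pi * (inner (defect_power t k x) (c k) + (if k = 0 then inner x (c k) else 0)))) {-pi..pi}"
    unfolding E by (intro has_integral_sum has_integral_square_function_kernel t) auto
  moreover have "(\<Sum>k<n. 2 * pi * (inner (defect_power t k x) (c k) + (if k = 0 then inner x (c k) else 0)))
    = 2 * pi * ((\<Sum>k<n. inner (defect_power t k x) (c k)) + (if 0 < n then inner x (c 0) else 0))"
    by (simp add: sum_distrib_left[symmetric] sum.distrib)
  ultimately have "(?E has_integral 2 * pi * ((\<Sum>k<n. inner (defect_power t k x) (c k)) + (if 0 < n then inner x (c 0) else 0))) {-pi..pi}"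
    by simp
  then show "2 * pi * ((\<Sum>k<n. inner (defect_power t k x) (c k)) + (if 0 < n then inner x (c 0) else 0))
      \<le> 2 * pi * (norm x)\<^sup>2 + 2 * H * (norm x)\<^sup>2 + 6 * C * (2 * pi * (\<Sum>k<n. (norm (c k))\<^sup>2))"
    by (rule has_integral_le_except_point[OF _ has_integral_majorant[of 1 x c n], where p=0])
       (auto intro!: resolvent_form_bound)
qed

text \<open>The left-hand side of \<open>resolvent_form_bound\<close> is symmetric in its two vectors. Hence the same
argument, now with \<open>\<beta> u = b \<cdot> \<Sum>\<^sub>k e\<^sup>-\<^sup>i\<^sup>k\<^sup>\<theta> c\<^sub>k\<close>, handles the adjoint operators without ever introducing
adjoints.\<close>

lemma sum_defect_power_adjoint_pairing_le:
  "inner x (\<Sum>k<n. defect_power t k (c k)) \<le> (2 + H / pi + 6 * C) * ((norm x)\<^sup>2 + (\<Sum>k<n. (norm (c k))\<^sup>2))"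
proof (rule pairing_bound_from_integrals)
  let ?w = "\<lambda>\<theta>. of_real t * cis \<theta>" and ?b = "\<lambda>\<theta>. csqrt_series (cis (- \<theta>))"
  let ?u = "\<lambda>\<theta>. \<Sum>k<n. cis (of_int (- 1 * int k) * \<theta>) *\<^sub>C c k"
  let ?E = "\<lambda>\<theta>. inner (Q (?w \<theta>) x) (?b \<theta> *\<^sub>C ?u \<theta>) + inner x (Q (?w \<theta>) (?b \<theta> *\<^sub>C ?u \<theta>))"
  have E: "?E \<theta> = (\<Sum>k<n. inner ((?b \<theta> * cis (- real k * \<theta>)) *\<^sub>C Q (?w \<theta>) (c k)) x
       + inner ((?b \<theta> * cis (- real k * \<theta>)) *\<^sub>C c k) (Q (?w \<theta>) x))" for \<theta>
  proof -
    have w: "cmod (?w \<theta>) < 1" using t by (simp add: norm_mult)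
    have u: "?b \<theta> *\<^sub>C ?u \<theta> = (\<Sum>k<n. (?b \<theta> * cis (- real k * \<theta>)) *\<^sub>C c k)"
      by (simp add: linear_sum[OF bounded_linear.linear[OF bounded_linear_scaleC]] scaleC_scaleC)
    show ?thesis
      unfolding u by (simp add: bounded_clinearD(4,7)[OF Q[OF w]] inner_sum_right sum.distrib inner_commute add.commute)
  qed
  have "(?E has_integral (\<Sum>k<n. 2 * pi * (inner (defect_power t k (c k)) x + (if k = 0 then inner (c k) x else 0)))) {-pi..pi}"
    unfolding E by (intro has_integral_sum has_integral_square_function_kernel t) auto
  moreover have "(\<Sum>k<n. 2 * pi * (inner (defect_power t k (c k)) x + (if k = 0 then inner (c k) x else 0)))
    = 2 * pi * (inner x (\<Sum>k<n. defect_power t k (c k)) + (if 0 < n then inner x (c 0) else 0))"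
    by (simp add: sum_distrib_left[symmetric] sum.distrib inner_sum_right inner_commute)
  ultimately have "(?E has_integral 2 * pi * (inner x (\<Sum>k<n. defect_power t k (c k)) + (if 0 < n then inner x (c 0) else 0))) {-pi..pi}"
    by simp
  then show "2 * pi * (inner x (\<Sum>k<n. defect_power t k (c k)) + (if 0 < n then inner x (c 0) else 0))
      \<le> 2 * pi * (norm x)\<^sup>2 + 2 * H * (norm x)\<^sup>2 + 6 * C * (2 * pi * (\<Sum>k<n. (norm (c k))\<^sup>2))"
    by (rule has_integral_le_except_point[OF _ has_integral_majorant[of "-1" x c n], where p=0])
       (auto intro!: resolvent_form_bound)
qed

lemma square_function_bound: "(\<Sum>k<n. (norm (defect_power t k x))\<^sup>2) \<le> 4 * (2 + H / pi + 6 * C)\<^sup>2 * (norm x)\<^sup>2"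
proof (rule quadratic_sqrt_bound)
  show "2 + H / pi + 6 * C > 0" using H_nonneg C by (simp add: add_pos_nonneg)
  show "0 \<le> (\<Sum>k<n. (norm (defect_power t k x))\<^sup>2)" by (intro sum_nonneg) simp
  show "e * (\<Sum>k<n. (norm (defect_power t k x))\<^sup>2) \<le> (2 + H / pi + 6 * C) * ((norm x)\<^sup>2 + e\<^sup>2 * (\<Sum>k<n. (norm (defect_power t k x))\<^sup>2))" for e
    using sum_defect_power_pairing_le[of x "\<lambda>k. e *\<^sub>R defect_power t k x" n]
    by (simp add: sum_distrib_left power_mult_distrib power2_norm_eq_inner)
qed

lemma dual_square_function_bound:
  "(norm (\<Sum>k<n. defect_power t k (c k)))\<^sup>2 \<le> 4 * (2 + H / pi + 6 * C)\<^sup>2 * (\<Sum>k<n. (norm (c k))\<^sup>2)"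
proof (rule quadratic_sqrt_bound)
  show "2 + H / pi + 6 * C > 0" using H_nonneg C by (simp add: add_pos_nonneg)
  let ?d = "\<Sum>k<n. defect_power t k (c k)"
  show "e * (norm ?d)\<^sup>2 \<le> (2 + H / pi + 6 * C) * ((\<Sum>k<n. (norm (c k))\<^sup>2) + e\<^sup>2 * (norm ?d)\<^sup>2)" for e
    using sum_defect_power_adjoint_pairing_le[of "e *\<^sub>R ?d" c n]
    by (simp add: power_mult_distrib power2_norm_eq_inner add.commute)
qed simp

end
end

section \<open>From square functions to a contractive norm\<close>

context resolvent_family
begin

lemma T_norm_bound:
  obtains b where "b \<ge> 0" "\<And>x. norm (T x) \<le> b * norm x"
proof -
  obtain b where "b > 0" "\<And>x. norm (T x) \<le> norm x * b"
    using bounded_linear.pos_bounded[OF bounded_clinearD(1)[OF T]] by blast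
  then show ?thesis using that[of b] by (simp add: mult.commute)
qed

text \<open>Since \<open>U\<^sub>j U\<^sub>j = (t T)\<^sup>2\<^sup>j (1 - t T)\<close>, the extra factor \<open>1 + t T\<close> turns each term into a difference of
consecutive even powers.\<close>

lemma telescope_defect_power:
  assumes pb: "power_bounded_by K (\<lambda>x. t *\<^sub>R T x)" and that: "m \<le> n"
  shows "(\<Sum>j=m..<n. defect_power t j (defect_power t j (x + t *\<^sub>R T x))) = t ^ (2*m) *\<^sub>R (T ^^ (2*m)) x - t ^ (2*n) *\<^sub>R (T ^^ (2*n)) x"
proof -
  let ?X = "\<lambda>x. t *\<^sub>R T x"
  have X: "bounded_clinear ?X" by (rule bounded_clinear_scaleR[OF T])
  have "defect_power t j (defect_power t j (x + ?X x)) = (?X ^^ (2*j)) x - (?X ^^ (2 * Suc j)) x" for j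
  proof -
    have "defect_power t j (defect_power t j (x + ?X x)) = (?X ^^ j) ((?X ^^ j) (sqrt_one_minus ?X (sqrt_one_minus ?X (x + ?X x))))"
      unfolding defect_power_def by (simp only: sqrt_one_minus_funpow[OF pb, symmetric])
    also have "\<dots> = (?X ^^ (2*j)) (x + ?X x - ?X (x + ?X x))"
      unfolding sqrt_one_minus_squared[OF pb] mult_2 by (simp add: funpow_add)
    also have "x + ?X x - ?X (x + ?X x) = x - ?X (?X x)"
      by (simp add: bounded_clinearD[OF T] algebra_simps)
    also have "(?X ^^ (2*j)) (x - ?X (?X x)) = (?X ^^ (2*j)) x - (?X ^^ (2*j)) ((?X ^^ 2) x)"
      by (simp only: bounded_clinearD(3)[OF bounded_clinear_funpow[OF X]]) (simp add: numeral_2_eq_2)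
    also have "(?X ^^ (2*j)) ((?X ^^ 2) x) = (?X ^^ (2 * Suc j)) x"
      by (simp only: mult_Suc_right add.commute[of 2] funpow_add comp_apply)
    finally show ?thesis .
  qed
  then have "(\<Sum>j=m..<n. defect_power t j (defect_power t j (x + ?X x))) = (\<Sum>j=m..<n. (?X ^^ (2*j)) x - (?X ^^ (2 * Suc j)) x)"
    by simp
  also have "\<dots> = (?X ^^ (2*m)) x - (?X ^^ (2*n)) x"
    using sum_Suc_diff'[OF that, of "\<lambda>j. - (?X ^^ (2*j)) x"] by simp
  finally show ?thesis by (simp only: funpow_scaleR_T)
qed

text \<open>Power boundedness of \<open>T\<close> makes the series of \<open>(1 - s T)\<^sup>1\<^sup>/\<^sup>2 x\<close> uniformly convergent in \<open>s\<close> up to \<open>s = 1\<close>.\<close>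

lemma defect_power_tendsto:
  assumes pb: "power_bounded_by K T" and t: "\<And>n. \<tau> n \<in> {0..1}" "\<tau> \<longlonglongrightarrow> 1"
  shows "(\<lambda>n. defect_power (\<tau> n) k x) \<longlonglongrightarrow> defect_power 1 k x"
proof -
  have eq: "defect_power s k x = s ^ k *\<^sub>R (T ^^ k) (\<Sum>j. sqrt_coeff j *\<^sub>R s ^ j *\<^sub>R (T ^^ j) x)" for s
    by (simp only: defect_power_def funpow_scaleR_T sqrt_one_minus_def)
  have "uniform_limit {0..1} (\<lambda>n s. \<Sum>j<n. sqrt_coeff j *\<^sub>R s ^ j *\<^sub>R (T ^^ j) x)
      (\<lambda>s. \<Sum>j. sqrt_coeff j *\<^sub>R s ^ j *\<^sub>R (T ^^ j) x) sequentially"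
  proof (rule Weierstrass_m_test)
    show "norm (sqrt_coeff j *\<^sub>R s ^ j *\<^sub>R (T ^^ j) x) \<le> \<bar>sqrt_coeff j\<bar> * (K * norm x)" if "s \<in> {0..1}" for j s
    proof -
      have "s ^ j * norm ((T ^^ j) x) \<le> 1 * (K * norm x)"
        using that power_bounded_by_norm_le[OF pb, of j x] by (intro mult_mono power_le_one) auto
      then show ?thesis using that by (simp add: abs_mult mult.assoc mult_left_mono)
    qed
    show "summable (\<lambda>j. \<bar>sqrt_coeff j\<bar> * (K * norm x))"
      by (intro summable_mult2 summable_abs_sqrt_coeff)
  qed
  then have "continuous_on {0..1} (\<lambda>s. \<Sum>j. sqrt_coeff j *\<^sub>R s ^ j *\<^sub>R (T ^^ j) x)"
    by (rule uniform_limit_theorem[rotated]) (auto intro!: always_eventually continuous_intros)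
  then have "continuous_on {0..1::real} (\<lambda>s. defect_power s k x)"
    unfolding eq
    by (intro continuous_intros bounded_linear.continuous_on[OF bounded_clinearD(1)[OF bounded_clinear_funpow[OF T]]])
  then show ?thesis
    by (rule continuous_on_tendsto_compose[OF _ t(2)]) (use t in auto)
qed

text \<open>The new norm is \<open>\<Sum>\<^sub>j \<parallel>T\<^sup>j (1 - T)\<^sup>1\<^sup>/\<^sup>2 x\<parallel>\<^sup>2 + \<parallel>P x\<parallel>\<^sup>2\<close>, with \<open>P\<close> the strong limit of \<open>T\<^sup>2\<^sup>n\<close>. The square
function estimate bounds it from above. The dual estimate, applied to the telescoping sum, bounds
\<open>\<parallel>x - P x\<parallel>\<close> by its first part, which gives the bound from below.\<close>

theorem similar_to_contraction_if_Re_bounded_below: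
  assumes h: "(h has_integral H) {-pi..pi}"
    and h_nonneg: "\<And>\<theta>. \<theta> \<in> {-pi..pi} \<Longrightarrow> 0 \<le> h \<theta>"
    and pos: "\<And>t \<theta> x. t \<in> {1/2..<1} \<Longrightarrow> \<theta> \<in> {-pi..pi} \<Longrightarrow> \<theta> \<noteq> 0 \<Longrightarrow>
        - (h \<theta> * (norm x)\<^sup>2) \<le> inner (Q (of_real t * cis \<theta>) x) x"
  shows "similar_to_contraction T"
proof -
  define k where "k = 4 * (2 + H / pi + 6 * C)\<^sup>2"
  have H0: "0 \<le> H" using has_integral_nonneg[OF h h_nonneg] .
  have k16: "k \<ge> 16"
  proof -
    have "2\<^sup>2 \<le> (2 + H / pi + 6 * C)\<^sup>2" using H0 C by (intro power_mono) auto
    then show ?thesis by (simp add: k_def)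
  qed
  obtain b where b: "b \<ge> 0" "\<And>x. norm (T x) \<le> b * norm x" using T_norm_bound by blast
  have sq: "(\<Sum>j<n. (norm (defect_power t j x))\<^sup>2) \<le> k * (norm x)\<^sup>2"
    and dual: "(norm (\<Sum>j<n. defect_power t j (c j)))\<^sup>2 \<le> k * (\<Sum>j<n. (norm (c j))\<^sup>2)"
    if "t \<in> {1/2..<1}" for t n x c
    unfolding k_def using square_function_bound[of t h H] dual_square_function_bound[of t h H] that pos h h_nonneg
    by auto
  define \<tau> where "\<tau> n = 1 - 1 / (real n + 2)" for n
  have \<tau>: "\<tau> n \<in> {1/2..<1}" for n by (auto simp: \<tau>_def field_simps)
  have \<tau>1: "\<tau> \<longlonglongrightarrow> 1" unfolding \<tau>_def by real_asymp
  \<comment> \<open>The telescoping sum bounds the even powers of \<open>t T\<close> by a constant that does not depend on \<open>t\<close>, so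
    that \<open>t\<close> can tend to \<open>1\<close>.\<close>
  define L where "L = 1 + k * (1 + b)"
  have L: "L \<ge> 0" using k16 b by (simp add: L_def)
  have even_bound: "norm ((T ^^ (2*n)) x) \<le> L * norm x" for n x
  proof -
    have "norm (t ^ (2*n) *\<^sub>R (T ^^ (2*n)) x) \<le> L * norm x" if t: "t \<in> {1/2..<1}" for t
    proof -
      have "power_bounded_by (C / (1 - t)) (\<lambda>x. t *\<^sub>R T x)" using t by (intro power_bounded_scaled) auto
      from telescope_defect_power[OF this, of 0 n x]
      have tel: "x - t ^ (2*n) *\<^sub>R (T ^^ (2*n)) x = (\<Sum>j<n. defect_power t j (defect_power t j (x + t *\<^sub>R T x)))"
        by (simp add: atLeast0LessThan)
      have "(norm (x - t ^ (2*n) *\<^sub>R (T ^^ (2*n)) x))\<^sup>2 \<le> k * (\<Sum>j<n. (norm (defect_power t j (x + t *\<^sub>R T x)))\<^sup>2)"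
        unfolding tel by (rule dual[OF t])
      also have "\<dots> \<le> k * (k * (norm (x + t *\<^sub>R T x))\<^sup>2)"
        using k16 by (intro mult_left_mono sq[OF t]) auto
      finally have "(norm (x - t ^ (2*n) *\<^sub>R (T ^^ (2*n)) x))\<^sup>2 \<le> (k * norm (x + t *\<^sub>R T x))\<^sup>2"
        by (simp add: power_mult_distrib power2_eq_square mult_ac)
      then have "norm (x - t ^ (2*n) *\<^sub>R (T ^^ (2*n)) x) \<le> k * norm (x + t *\<^sub>R T x)"
        by (rule power2_le_imp_le) (use k16 in auto)
      moreover have "norm (t ^ (2*n) *\<^sub>R (T ^^ (2*n)) x) \<le> norm x + norm (x - t ^ (2*n) *\<^sub>R (T ^^ (2*n)) x)"
        by (metis norm_minus_commute norm_triangle_sub)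
      moreover have "norm (x + t *\<^sub>R T x) \<le> (1 + b) * norm x"
      proof -
        have "t * norm (T x) \<le> 1 * (b * norm x)" using t b(2)[of x] by (intro mult_mono) auto
        then show ?thesis using norm_triangle_ineq[of x "t *\<^sub>R T x"] t by (simp add: algebra_simps)
      qed
      then have "k * norm (x + t *\<^sub>R T x) \<le> k * ((1 + b) * norm x)" using k16 by (intro mult_left_mono) auto
      ultimately show ?thesis by (simp add: L_def algebra_simps)
    qed
    then have "norm (\<tau> i ^ (2*n) *\<^sub>R (T ^^ (2*n)) x) \<le> L * norm x" for i using \<tau> by blast
    moreover have "(\<lambda>i. norm (\<tau> i ^ (2*n) *\<^sub>R (T ^^ (2*n)) x)) \<longlonglongrightarrow> norm (1 ^ (2*n) *\<^sub>R (T ^^ (2*n)) x)"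
      by (intro tendsto_intros \<tau>1)
    ultimately have "norm (1 ^ (2*n) *\<^sub>R (T ^^ (2*n)) x) \<le> L * norm x"
      by (intro LIMSEQ_le_const2) auto
    then show ?thesis by simp
  qed
  define K where "K = L * (1 + b)"
  have pb: "power_bounded_by K T"
    unfolding power_bounded_by_def
  proof (intro conjI allI T)
    fix n and x :: 'a
    show "norm ((T ^^ n) x) \<le> K * norm x"
    proof (cases "even n")
      case True
      then obtain m where "n = 2 * m" by (rule evenE)
      then have "norm ((T ^^ n) x) \<le> L * norm x" using even_bound by simp
      also have "\<dots> \<le> K * norm x" using L b by (simp add: K_def mult_right_mono algebra_simps)
      finally show ?thesis .
    next
      case False
      then obtain m where n: "n = 2 * m + 1" by (rule oddE)
      have "norm ((T ^^ n) x) \<le> L * norm (T x)" using even_bound[of m "T x"] by (simp add: n funpow_swap1)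
      also have "\<dots> \<le> L * ((1 + b) * norm x)"
        using b L by (intro mult_left_mono) (auto simp: algebra_simps intro: add_increasing)
      finally show ?thesis by (simp add: K_def)
    qed
  qed
  define V where "V = defect_power 1"
  have V_eq: "V j x = (T ^^ j) (sqrt_one_minus T x)" for j x by (simp add: V_def defect_power_def)
  have V: "bounded_clinear (V j)" for j
    using bounded_clinear_compose[OF bounded_clinear_funpow[OF T] bounded_clinear_sqrt_one_minus[OF pb], of j]
    by (simp add: V_eq[abs_def])
  have VT: "V j (T x) = V (Suc j) x" for j x
    using sqrt_one_minus_funpow[OF pb, of 1 x] by (simp add: V_eq funpow_swap1)
  have Vlim: "(\<lambda>n. defect_power (\<tau> n) j x) \<longlonglongrightarrow> V j x" for j x
    unfolding V_def by (rule defect_power_tendsto[OF pb _ \<tau>1]) (use \<tau> in \<open>auto intro: less_imp_le order_trans[of 0 "1/2"]\<close>)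
  have sqV: "(\<Sum>j<n. (norm (V j x))\<^sup>2) \<le> k * (norm x)\<^sup>2" for n x
    by (rule LIMSEQ_le_const2[where X="\<lambda>i. \<Sum>j<n. (norm (defect_power (\<tau> i) j x))\<^sup>2"])
       (auto intro!: tendsto_intros Vlim sq \<tau>)
  have dualV: "(norm (\<Sum>j<n. V j (c j)))\<^sup>2 \<le> k * (\<Sum>j<n. (norm (c j))\<^sup>2)" for n c
    by (rule LIMSEQ_le_const2[where X="\<lambda>i. (norm (\<Sum>j<n. defect_power (\<tau> i) j (c j)))\<^sup>2"])
       (auto intro!: tendsto_intros Vlim dual \<tau>)
  have smV: "summable (\<lambda>j. (norm (V j x))\<^sup>2)" for x
    by (rule summableI_nonneg_bounded[OF _ sqV]) simp
  have V0: "(\<lambda>j. V j x) \<longlonglongrightarrow> 0" for x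
  proof -
    have "(\<lambda>j. sqrt ((norm (V j x))\<^sup>2)) \<longlonglongrightarrow> sqrt 0"
      by (intro tendsto_intros summable_LIMSEQ_zero[OF smV])
    then show ?thesis using tendsto_norm_zero_iff by force
  qed
  \<comment> \<open>The dual estimate for the vectors \<open>c j = V j (x + T x)\<close> with \<open>m \<le> j < n\<close>; the right-hand side is the
    tail of a convergent series.\<close>
  have tail: "(norm ((T ^^ (2*m)) x - (T ^^ (2*n)) x))\<^sup>2 \<le> k * (\<Sum>j=m..<n. (norm (V j (x + T x)))\<^sup>2)" if "m \<le> n" for m n x
  proof -
    have split: "{..<n} = {..<m} \<union> {m..<n}" "{..<m} \<inter> {m..<n} = {}" using that by auto
    have "(T ^^ (2*m)) x - (T ^^ (2*n)) x = (\<Sum>j=m..<n. V j (V j (x + T x)))"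
      using telescope_defect_power[of K 1 m n x] pb that by (simp add: V_def)
    also have "\<dots> = (\<Sum>j<n. V j (if j < m then 0 else V j (x + T x)))"
      unfolding split(1) by (subst sum.union_disjoint) (auto simp: bounded_clinearD[OF V])
    finally have "(norm ((T ^^ (2*m)) x - (T ^^ (2*n)) x))\<^sup>2
        \<le> k * (\<Sum>j<n. (norm (if j < m then 0 else V j (x + T x)))\<^sup>2)"
      using dualV by simp
    also have "(\<Sum>j<n. (norm (if j < m then 0 else V j (x + T x)))\<^sup>2) = (\<Sum>j=m..<n. (norm (V j (x + T x)))\<^sup>2)"
      unfolding split(1) by (subst sum.union_disjoint) auto
    finally show ?thesis .
  qed
  have "convergent (\<lambda>n. (T ^^ (2*n)) x)" for x
  proof -
    have "Cauchy (\<lambda>n. (T ^^ (2*n)) x)"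
    proof (rule CauchyI')
      fix e :: real assume e: "e > 0"
      obtain M where M: "\<And>m n. m \<ge> M \<Longrightarrow> norm (\<Sum>j=m..<n. (norm (V j (x + T x)))\<^sup>2) < e\<^sup>2 / k"
        using summable_Cauchy[THEN iffD1, OF smV, rule_format, of "e\<^sup>2/k" "x + T x"] e k16 by auto
      show "\<exists>M. \<forall>m\<ge>M. \<forall>n>m. dist ((T ^^ (2*m)) x) ((T ^^ (2*n)) x) < e"
      proof (intro exI[of _ M] allI impI)
        fix m n assume "m \<ge> M" "m < n"
        then have "(norm ((T ^^ (2*m)) x - (T ^^ (2*n)) x))\<^sup>2 \<le> k * (\<Sum>j=m..<n. (norm (V j (x + T x)))\<^sup>2)"
          by (intro tail) simp
        also have "\<dots> < k * (e\<^sup>2 / k)"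
          using M[OF \<open>m \<ge> M\<close>, of n] k16 by (intro mult_strict_left_mono) auto
        also have "\<dots> = e\<^sup>2" using k16 by simp
        finally show "dist ((T ^^ (2*m)) x) ((T ^^ (2*n)) x) < e"
          using e by (simp add: dist_norm power2_less_imp_less)
      qed
    qed
    then show ?thesis by (simp add: Cauchy_convergent_iff)
  qed
  then obtain P where P: "\<And>x. (\<lambda>n. (T ^^ (2*n)) x) \<longlonglongrightarrow> P x" unfolding convergent_def by metis
  note Tn = bounded_clinearD[OF bounded_clinear_funpow[OF T]]
  have Padd: "P (x + y) = P x + P y" for x y
    using LIMSEQ_unique[OF P[of "x + y"]] tendsto_add[OF P[of x] P[of y]] by (simp add: Tn)
  have PscaleC: "P (c *\<^sub>C x) = c *\<^sub>C P x" for c x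
    using LIMSEQ_unique[OF P[of "c *\<^sub>C x"]] bounded_linear.tendsto[OF bounded_linear_scaleC P[of x]] by (simp add: Tn)
  have Pscale: "P (a *\<^sub>R x) = a *\<^sub>R P x" for a x
    using PscaleC[of "of_real a" x] by (simp add: scaleC_of_real)
  have Pnorm: "norm (P x) \<le> K * norm x" for x
    by (rule LIMSEQ_le_const2[OF tendsto_norm[OF P]]) (use power_bounded_by_norm_le[OF pb] in auto)
  have PT: "P (T x) = P x" for x
  proof -
    have "(\<lambda>n. V (2 * n) (sqrt_one_minus T x)) \<longlonglongrightarrow> 0"
      using LIMSEQ_subseq_LIMSEQ[OF V0, of "\<lambda>n. 2 * n"] by (simp add: strict_mono_def o_def)
    moreover have "V (2 * n) (sqrt_one_minus T x) = (T ^^ (2*n)) x - (T ^^ (2*n)) (T x)" for n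
      by (simp add: V_eq sqrt_one_minus_squared[OF pb] Tn)
    moreover have "(\<lambda>n. (T ^^ (2*n)) x - (T ^^ (2*n)) (T x)) \<longlonglongrightarrow> P x - P (T x)"
      by (intro tendsto_diff P)
    ultimately have "P x - P (T x) = 0" by (intro LIMSEQ_unique[of _ "P x - P (T x)" 0]) simp_all
    then show ?thesis by simp
  qed
  define N where "N x y = (\<Sum>j. inner (V j x) (V j y)) + inner (P x) (P y)" for x y
  have smN: "summable (\<lambda>j. inner (V j x) (V j y))" for x y
  proof (rule summable_comparison_test'[where N=0])
    show "summable (\<lambda>j. (norm (V j x))\<^sup>2 + (norm (V j y))\<^sup>2)" by (intro summable_add smV)
    show "norm (inner (V j x) (V j y)) \<le> (norm (V j x))\<^sup>2 + (norm (V j y))\<^sup>2" for j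
    proof -
      have "\<bar>inner (V j x) (V j y)\<bar> \<le> norm (V j x) * norm (V j y)" by (rule Cauchy_Schwarz_ineq2)
      also have "\<dots> \<le> (norm (V j x))\<^sup>2 + (norm (V j y))\<^sup>2"
        using sum_squares_bound[of "norm (V j x)" "norm (V j y)"]
          mult_nonneg_nonneg[OF norm_ge_zero[of "V j x"] norm_ge_zero[of "V j y"]]
        by linarith
      finally show ?thesis by simp
    qed
  qed
  have Nxx: "N x x = (\<Sum>j. (norm (V j x))\<^sup>2) + (norm (P x))\<^sup>2" for x
    by (simp add: N_def power2_norm_eq_inner)
  have VS: "(\<Sum>j. (norm (V (Suc j) x))\<^sup>2) \<le> (\<Sum>j. (norm (V j x))\<^sup>2)" for x
    using suminf_split_head[OF smV, of x] by simp
  \<comment> \<open>The lower constant comes from \<open>\<parallel>x\<parallel>\<^sup>2 \<le> 2 \<parallel>x - P x\<parallel>\<^sup>2 + 2 \<parallel>P x\<parallel>\<^sup>2\<close> and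
    \<open>\<parallel>x - P x\<parallel>\<^sup>2 \<le> 4 k \<Sum>\<^sub>j \<parallel>V j x\<parallel>\<^sup>2\<close>.\<close>
  show ?thesis
  proof (rule similar_to_contraction_if_form[OF T, where N=N and m="1 / (8 * k + 2)" and M="k + K\<^sup>2"])
    show "linear (N x)" for x
    proof (rule linearI)
      show "N x (y + z) = N x y + N x z" for y z
        by (simp add: N_def bounded_clinearD[OF V] Padd inner_add_right suminf_add[OF smN smN, symmetric])
      show "N x (a *\<^sub>R y) = a *\<^sub>R N x y" for a y
        by (simp add: N_def bounded_clinearD[OF V] Pscale suminf_mult[OF smN] distrib_left)
    qed
    show "N x y = N y x" for x y by (simp add: N_def inner_commute)
    show "N (c *\<^sub>C x) y = N x (cnj c *\<^sub>C y)" for c x y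
      by (simp add: N_def bounded_clinearD[OF V] PscaleC inner_scaleC_cnj)
    show "0 < 1 / (8 * k + 2)" using k16 by simp
    have "1 / (8 * k + 2) \<le> 1" using k16 by simp
    then show "1 / (8 * k + 2) \<le> k + K\<^sup>2" using k16 zero_le_power2[of K] by linarith
    show "N x x \<le> (k + K\<^sup>2) * (norm x)\<^sup>2" for x
    proof -
      have "(norm (P x))\<^sup>2 \<le> (K * norm x)\<^sup>2" by (intro power_mono Pnorm) auto
      moreover have "(\<Sum>j. (norm (V j x))\<^sup>2) \<le> k * (norm x)\<^sup>2"
        by (rule suminf_le_const[OF smV sqV])
      ultimately show ?thesis unfolding Nxx by (simp add: power_mult_distrib algebra_simps)
    qed
    show "N (T x) (T x) \<le> N x x" for x
      using VS[of x] by (simp add: Nxx VT PT)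
    show "1 / (8 * k + 2) * (norm x)\<^sup>2 \<le> N x x" for x
    proof -
      let ?s = "\<Sum>j. (norm (V j x))\<^sup>2"
      have two: "(norm (u + v))\<^sup>2 \<le> 2 * (norm u)\<^sup>2 + 2 * (norm v)\<^sup>2" for u v :: 'a
      proof -
        have "0 \<le> (norm (u - v))\<^sup>2" by simp
        then show ?thesis by (simp add: power2_norm_eq_inner inner_diff inner_add inner_commute)
      qed
      have s0: "0 \<le> ?s" by (rule suminf_nonneg[OF smV]) simp
      have "(norm (x - P x))\<^sup>2 \<le> k * (4 * ?s)"
      proof (rule LIMSEQ_le_const2)
        show "(\<lambda>n. (norm (x - (T ^^ (2*n)) x))\<^sup>2) \<longlonglongrightarrow> (norm (x - P x))\<^sup>2"
          by (intro tendsto_intros P)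
        have "(norm (x - (T ^^ (2*n)) x))\<^sup>2 \<le> k * (4 * ?s)" for n
        proof -
          have "(\<Sum>j=0..<n. (norm (V j (x + T x)))\<^sup>2) \<le> (\<Sum>j=0..<n. 2 * (norm (V j x))\<^sup>2 + 2 * (norm (V (Suc j) x))\<^sup>2)"
            using two by (intro sum_mono) (simp add: bounded_clinearD[OF V] VT)
          also have "\<dots> = 2 * (\<Sum>j<n. (norm (V j x))\<^sup>2) + 2 * (\<Sum>j<n. (norm (V (Suc j) x))\<^sup>2)"
            by (simp add: sum.distrib sum_distrib_left atLeast0LessThan)
          also have "\<dots> \<le> 2 * ?s + 2 * (\<Sum>j. (norm (V (Suc j) x))\<^sup>2)"
            using smV[of x] summable_Suc_iff[of "\<lambda>j. (norm (V j x))\<^sup>2"]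
            by (intro add_mono mult_left_mono sum_le_suminf) auto
          also have "\<dots> \<le> 4 * ?s" using VS[of x] by simp
          finally have "k * (\<Sum>j=0..<n. (norm (V j (x + T x)))\<^sup>2) \<le> k * (4 * ?s)"
            using k16 by (intro mult_left_mono) auto
          then show ?thesis using tail[of 0 n x] by simp
        qed
        then show "\<exists>N. \<forall>n\<ge>N. (norm (x - (T ^^ (2*n)) x))\<^sup>2 \<le> k * (4 * ?s)" by blast
      qed
      moreover have "(norm x)\<^sup>2 \<le> 2 * (norm (x - P x))\<^sup>2 + 2 * (norm (P x))\<^sup>2"
        using two[of "x - P x" "P x"] by simp
      moreover have "(8 * k + 2) * N x x = 8 * k * ?s + 2 * ?s + 8 * k * (norm (P x))\<^sup>2 + 2 * (norm (P x))\<^sup>2"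
        unfolding Nxx by (simp add: algebra_simps)
      moreover have "0 \<le> 8 * k * (norm (P x))\<^sup>2" using k16 by simp
      ultimately have "(norm x)\<^sup>2 \<le> (8 * k + 2) * N x x" using s0 by linarith
      then show ?thesis using k16 by (simp add: field_simps)
    qed
  qed
qed

end

section \<open>Lower bounds for the resolvent from the v-type curve\<close>

text \<open>The sine is concave on \<open>[0, \<pi>]\<close> and so lies above its chord.\<close>

lemma sin_ge_linear:
  fixes x :: real
  assumes "0 \<le> x" "x \<le> pi / 2" shows "2 / pi * x \<le> sin x"
proof -
  have "convex_on {0..pi} (\<lambda>x::real. - sin x)"
  proof (rule f''_ge0_imp_convex[where f'="\<lambda>x. - cos x" and f''="\<lambda>x. sin x"])
    show "\<And>x. x \<in> {0..pi} \<Longrightarrow> 0 \<le> sin x" by (auto intro: sin_ge_zero)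
  qed (auto intro!: derivative_eq_intros)
  then have "- sin ((1 - 2 / pi * x) *\<^sub>R 0 + (2 / pi * x) *\<^sub>R (pi / 2))
      \<le> (1 - 2 / pi * x) * (- sin 0) + (2 / pi * x) * (- sin (pi / 2))"
    using assms by (intro convex_onD) (auto simp: field_simps)
  then show ?thesis by simp
qed

lemma cmod_one_minus_cis_ge:
  assumes "\<bar>\<theta>\<bar> \<le> pi" shows "2 / pi * \<bar>\<theta>\<bar> \<le> cmod (1 - cis \<theta>)"
proof -
  have "cmod (1 - cis \<theta>) = 2 * \<bar>sin (\<theta> / 2)\<bar>"
    using dist_exp_i_1[of \<theta>] by (simp add: cis_conv_exp norm_minus_commute)
  moreover have "\<bar>sin (\<theta> / 2)\<bar> = \<bar>sin (\<bar>\<theta>\<bar> / 2)\<bar>" by (simp add: abs_if)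
  moreover have "2 / pi * (\<bar>\<theta>\<bar> / 2) \<le> sin (\<bar>\<theta>\<bar> / 2)" using assms by (intro sin_ge_linear) auto
  moreover have "sin (\<bar>\<theta>\<bar> / 2) \<le> \<bar>sin (\<bar>\<theta>\<bar> / 2)\<bar>" by (rule abs_ge_self)
  ultimately show ?thesis by simp
qed

lemma resolvent_inverse:
  assumes z: "z \<notin> spectrum T"
  shows "bounded_clinear (resolvent T z)" "resolvent T z (z *\<^sub>C x - T x) = x"
    "z *\<^sub>C resolvent T z x - T (resolvent T z x) = x"
proof -
  obtain R where R: "bounded_clinear R" "\<And>x. R (z *\<^sub>C x - T x) = x" "\<And>x. z *\<^sub>C R x - T (R x) = x"
    using z by (auto simp: spectrum_def)
  have "resolvent T z = R"
    unfolding resolvent_def by (rule inv_equality) (use R in auto)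
  then show "bounded_clinear (resolvent T z)" "resolvent T z (z *\<^sub>C x - T x) = x"
    "z *\<^sub>C resolvent T z x - T (resolvent T z x) = x"
    using R by auto
qed

text \<open>\<open>(1 - w T)\<^sup>-\<^sup>1\<close>, expressed by the resolvent; the value at \<open>w = 0\<close> fills the point \<open>\<lambda> = \<infinity>\<close>.\<close>

definition inv_one_minus :: "('a::complex_hilbert_space \<Rightarrow> 'a) \<Rightarrow> complex \<Rightarrow> 'a \<Rightarrow> 'a" where
  "inv_one_minus T w x = (if w = 0 then x else (1 / w) *\<^sub>C resolvent T (1 / w) x)"

text \<open>In the variable \<open>w = 1 / \<lambda>\<close> the bound \<open>C / \<bar>\<lambda> - 1\<bar>\<close> becomes \<open>C / \<bar>1 - w\<bar>\<close>.\<close>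

lemma ritt_resolvent_family:
  assumes "ritt_operator T"
  obtains C where "resolvent_family T (inv_one_minus T) C"
proof -
  from assms obtain C where T: "bounded_clinear T" and sp: "spectrum T \<subseteq> cball 0 1" and "C > 0"
    and C: "\<And>z. cmod z > 1 \<Longrightarrow> onorm (resolvent T z) \<le> C / cmod (z - 1)"
    by (auto simp: ritt_operator_def)
  have out: "1 / w \<notin> spectrum T" "cmod (1 / w) > 1" if "cmod w < 1" "w \<noteq> 0" for w
  proof -
    show g: "cmod (1 / w) > 1" using that by (simp add: norm_divide)
    then show "1 / w \<notin> spectrum T" using sp by auto
  qed
  have "resolvent_family T (inv_one_minus T) (max 1 C)"
  proof
    show "bounded_clinear T" by (rule T)
    fix w :: complex and x :: 'a assume w: "cmod w < 1"
    show "bounded_clinear (inv_one_minus T w)"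
    proof (cases "w = 0")
      case True
      then show ?thesis using bounded_clinear_id by (simp add: inv_one_minus_def[abs_def])
    next
      case False
      then show ?thesis
        using bounded_clinear_scaleC[OF resolvent_inverse(1)[OF out(1)[OF w]]]
        by (simp add: inv_one_minus_def[abs_def])
    qed
    show "inv_one_minus T w (x - w *\<^sub>C T x) = x"
    proof (cases "w = 0")
      case False
      note R = resolvent_inverse[OF out(1)[OF w False]]
      have "(1 / w) *\<^sub>C (x - w *\<^sub>C T x) = (1 / w) *\<^sub>C x - T x"
        using False by (simp add: scaleC_diff_right scaleC_scaleC)
      then show ?thesis using False R(2)[of x] bounded_clinearD(4)[OF R(1)]
        by (simp add: inv_one_minus_def flip: bounded_clinearD(4)[OF R(1)])
    qed (simp add: inv_one_minus_def)
    show "inv_one_minus T w x - w *\<^sub>C T (inv_one_minus T w x) = x"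
    proof (cases "w = 0")
      case False
      note R = resolvent_inverse[OF out(1)[OF w False]]
      show ?thesis using False R(3)[of x]
        by (simp add: inv_one_minus_def bounded_clinearD[OF T] scaleC_scaleC)
    qed (simp add: inv_one_minus_def)
    show "norm (inv_one_minus T w x) \<le> max 1 C / cmod (1 - w) * norm x"
    proof (cases "w = 0")
      case True
      then show ?thesis using mult_right_mono[of 1 "max 1 C" "norm x"] by (simp add: inv_one_minus_def)
    next
      case False
      note R = resolvent_inverse[OF out(1)[OF w False]]
      have nz: "1 - w \<noteq> 0" using w by auto
      have "norm (resolvent T (1 / w) x) \<le> onorm (resolvent T (1 / w)) * norm x"
        by (rule onorm[OF bounded_clinearD(1)[OF R(1)]])
      also have "\<dots> \<le> C / cmod (1 / w - 1) * norm x"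
        by (intro mult_right_mono C out w False) auto
      also have "1 / w - 1 = (1 - w) / w" using False by (simp add: field_simps)
      finally have "norm (resolvent T (1 / w) x) \<le> C * cmod w / cmod (1 - w) * norm x"
        by (simp add: norm_divide)
      then have "(1 / cmod w) * norm (resolvent T (1 / w) x) \<le> (1 / cmod w) * (C * cmod w / cmod (1 - w) * norm x)"
        by (rule mult_left_mono) simp
      then have "norm (inv_one_minus T w x) \<le> (1 / cmod w) * (C * cmod w / cmod (1 - w) * norm x)"
        using False by (simp only: inv_one_minus_def norm_scaleC norm_divide norm_one if_False)
      also have "\<dots> = C / cmod (1 - w) * norm x" using False by simp
      also have "\<dots> \<le> max 1 C / cmod (1 - w) * norm x"
        by (intro mult_right_mono divide_right_mono) auto
      finally show ?thesis .
    qed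
  next
    show "0 \<le> max 1 C" by simp
  qed
  then show ?thesis by (rule that)
qed

context resolvent_family
begin

text \<open>Let \<open>\<rho> = 1 / t\<close>, \<open>\<lambda> = \<rho> e\<^sup>-\<^sup>i\<^sup>\<theta>\<close> and \<open>\<mu> = (1 + s) e\<^sup>-\<^sup>i\<^sup>\<theta>\<close>, two points on one ray, and let \<open>z = Q y\<close>. Then
\<open>(\<mu> - T) z = e\<^sup>-\<^sup>i\<^sup>\<theta> (s' z + \<rho> y)\<close> with \<open>s' = s - (\<rho> - 1)\<close>. The lower bound for \<open>\<mu> - T\<close> gives
\<open>\<parallel>s' z + \<rho> y\<parallel>\<^sup>2 \<ge> (1 - 2 e) s'\<^sup>2 \<parallel>z\<parallel>\<^sup>2\<close>; the terms \<open>s'\<^sup>2 \<parallel>z\<parallel>\<^sup>2\<close> cancel and a lower bound for the mixed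
term \<open>inner z y\<close> remains.\<close>

lemma inner_Q_ge_near_contractive_point:
  assumes t: "1/2 \<le> t" "t < 1" and s: "1 / t - 1 \<le> s / 2" and e: "0 \<le> e"
    and res: "\<And>z. norm z \<le> (1 + e) / s * norm ((of_real (1 + s) * cis (- \<theta>)) *\<^sub>C z - T z)"
  shows "- (2 / s * (norm y)\<^sup>2 + e * s * (norm (Q (of_real t * cis \<theta>) y))\<^sup>2) \<le> inner (Q (of_real t * cis \<theta>) y) y"
proof -
  define \<rho> where "\<rho> = 1 / t"
  define s' where "s' = s - (\<rho> - 1)"
  define z where "z = Q (of_real t * cis \<theta>) y"
  have \<rho>: "1 < \<rho>" "\<rho> \<le> 2" using t by (auto simp: \<rho>_def field_simps)
  have s': "0 < s" "s / 2 \<le> s'" "s' \<le> s" using s \<rho> by (auto simp: s'_def \<rho>_def)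
  define n where "n = norm (s' *\<^sub>R z + \<rho> *\<^sub>R y)"
  have w: "cmod (of_real t * cis \<theta>) < 1" using t by (simp add: norm_mult)
  have "(of_real (1 + s) * cis (- \<theta>)) *\<^sub>C z - T z = cis (- \<theta>) *\<^sub>C (s' *\<^sub>R z + \<rho> *\<^sub>R y)"
  proof -
    have y: "y = z - (of_real t * cis \<theta>) *\<^sub>C T z" using Q_right[OF w, of y] by (simp add: z_def)
    have "cis (- \<theta>) *\<^sub>C (\<rho> *\<^sub>R y) = (of_real \<rho> * cis (- \<theta>)) *\<^sub>C y"
      by (simp only: scaleC_scaleR_right scaleC_of_real_mult)
    also have "\<dots> = (of_real \<rho> * cis (- \<theta>)) *\<^sub>C z - (of_real \<rho> * cis (- \<theta>) * (of_real t * cis \<theta>)) *\<^sub>C T z"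
      by (simp only: y scaleC_diff_right scaleC_scaleC)
    also have "of_real \<rho> * cis (- \<theta>) * (of_real t * cis \<theta>) = 1"
      using t by (simp add: \<rho>_def cis_mult field_simps flip: of_real_mult)
    finally have "cis (- \<theta>) *\<^sub>C (s' *\<^sub>R z + \<rho> *\<^sub>R y) = (of_real s' * cis (- \<theta>) + of_real \<rho> * cis (- \<theta>)) *\<^sub>C z - T z"
      by (simp add: scaleC_add_right scaleC_add_left scaleC_scaleR_right scaleC_of_real_mult)
    also have "of_real s' * cis (- \<theta>) + of_real \<rho> * cis (- \<theta>) = of_real (1 + s) * cis (- \<theta>)"
      by (simp add: s'_def algebra_simps)
    finally show ?thesis by simp
  qed
  then have "norm z \<le> (1 + e) / s * n" using res[of z] by (simp add: n_def)
  then have "s * norm z \<le> (1 + e) * n" using s'(1) by (simp add: field_simps)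
  then have "s' * norm z \<le> (1 + e) * n" using mult_right_mono[OF s'(3), of "norm z"] by simp
  then have "(s' * norm z)\<^sup>2 \<le> ((1 + e) * n)\<^sup>2" using s' by (intro power_mono) auto
  then have "(1 - 2 * e) * (s' * norm z)\<^sup>2 \<le> n\<^sup>2"
  proof (cases "1 - 2 * e \<ge> 0")
    case True
    have "(1 - 2 * e) * (s' * norm z)\<^sup>2 \<le> (1 - 2 * e) * ((1 + e) * n)\<^sup>2"
      by (rule mult_left_mono) fact+
    also have "\<dots> = (1 - e\<^sup>2 * (3 + 2 * e)) * n\<^sup>2" by (simp add: power2_eq_square algebra_simps)
    also have "\<dots> \<le> 1 * n\<^sup>2" using e by (intro mult_right_mono) auto
    finally show ?thesis by simp
  next
    case False
    then have "(1 - 2 * e) * (s' * norm z)\<^sup>2 \<le> 0" by (intro mult_nonpos_nonneg) auto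
    then show ?thesis using zero_le_power2[of n] by linarith
  qed
  moreover have "n\<^sup>2 = (s' * norm z)\<^sup>2 + 2 * s' * \<rho> * inner z y + \<rho>\<^sup>2 * (norm y)\<^sup>2"
    unfolding n_def power_mult_distrib power2_norm_eq_inner
    by (simp add: inner_add inner_commute power2_eq_square algebra_simps)
  ultimately have "- (\<rho>\<^sup>2 * (norm y)\<^sup>2 + 2 * e * (s' * norm z)\<^sup>2) \<le> 2 * s' * \<rho> * inner z y"
    by (simp add: algebra_simps)
  then have "- ((\<rho>\<^sup>2 * (norm y)\<^sup>2 + 2 * e * (s' * norm z)\<^sup>2) / (2 * s' * \<rho>)) \<le> inner z y"
    using s' \<rho> unfolding minus_divide_left by (subst pos_divide_le_eq) (auto simp: mult_ac)
  moreover have "(\<rho>\<^sup>2 * (norm y)\<^sup>2 + 2 * e * (s' * norm z)\<^sup>2) / (2 * s' * \<rho>)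
      = \<rho> / (2 * s') * (norm y)\<^sup>2 + e * (s' / \<rho>) * (norm z)\<^sup>2"
    using s' \<rho> by (simp add: field_simps power2_eq_square)
  moreover have "\<rho> / (2 * s') * (norm y)\<^sup>2 \<le> 2 / s * (norm y)\<^sup>2"
    using s' \<rho> mult_mono[of \<rho> 2 s "2 * s'"] by (intro mult_right_mono) (auto simp: field_simps)
  moreover have "e * (s' / \<rho>) * (norm z)\<^sup>2 \<le> e * s * (norm z)\<^sup>2"
  proof -
    have "s' / \<rho> \<le> s' / 1" using s' \<rho> by (intro divide_left_mono) auto
    then show ?thesis using s' e by (intro mult_right_mono mult_left_mono) auto
  qed
  ultimately show ?thesis unfolding z_def[symmetric] by linarith
qed

lemma inner_Q_ge:
  assumes w: "cmod w < 1" and b: "0 < b" "b \<le> cmod (1 - w)"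
  shows "- (C / b * (norm x)\<^sup>2) \<le> inner (Q w x) x" "norm (Q w x) \<le> C / b * norm x"
proof -
  have "0 < cmod (1 - w)" using b by linarith
  then have "C / cmod (1 - w) \<le> C / b" using b C by (intro divide_left_mono mult_pos_pos) auto
  then show n: "norm (Q w x) \<le> C / b * norm x"
    using Q_norm[OF w, of x] mult_right_mono[of "C / cmod (1 - w)" "C / b" "norm x"] by simp
  have "\<bar>inner (Q w x) x\<bar> \<le> norm (Q w x) * norm x" by (rule Cauchy_Schwarz_ineq2)
  also have "\<dots> \<le> C / b * norm x * norm x" by (intro mult_right_mono n) auto
  finally show "- (C / b * (norm x)\<^sup>2) \<le> inner (Q w x) x" by (simp add: power2_eq_square)
qed

end

text \<open>This converts the integrability assumptions, which are Lebesgue integrals of nonnegative functions,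
into gauge integrals. The integrands in question are continuous only off \<open>\<theta> = 0\<close>, hence the set \<open>A\<close>.\<close>

lemma has_integral_of_nn_integral_finite:
  fixes f :: "real \<Rightarrow> real"
  assumes A: "A \<in> sets borel" "A \<subseteq> {a..b}" and f: "continuous_on A f" "\<And>x. x \<in> A \<Longrightarrow> 0 \<le> f x"
    and fin: "(\<integral>\<^sup>+x\<in>{c..d}. ennreal (g x) \<partial>lborel) < \<infinity>"
    and g: "\<And>x. x \<in> A \<Longrightarrow> x \<in> {c..d} \<and> g x = f x"
  obtains I where "((\<lambda>x. indicator A x * f x) has_integral I) {a..b}"
proof -
  have "integrable lborel (\<lambda>x. indicator A x *\<^sub>R f x)"
  proof (rule integrableI_nonneg)
    show "(\<lambda>x. indicator A x *\<^sub>R f x) \<in> borel_measurable lborel"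
      using borel_measurable_continuous_on_indicator[OF A(1) f(1)] by simp
    show "AE x in lborel. 0 \<le> indicator A x *\<^sub>R f x" using f(2) by (auto simp: indicator_def)
    have "(\<integral>\<^sup>+x. ennreal (indicator A x *\<^sub>R f x) \<partial>lborel) \<le> (\<integral>\<^sup>+x\<in>{c..d}. ennreal (g x) \<partial>lborel)"
      by (intro nn_integral_mono) (use g in \<open>auto simp: indicator_def\<close>)
    then show "(\<integral>\<^sup>+x. ennreal (indicator A x *\<^sub>R f x) \<partial>lborel) < \<infinity>" using fin by (rule le_less_trans)
  qed
  from has_integral_integral_lborel[OF this] 
  have "((\<lambda>x. indicator A x * f x) has_integral integral\<^sup>L lborel (\<lambda>x. indicator A x * f x)) UNIV" by simp
  moreover have "(\<lambda>x. indicator A x * f x) = (\<lambda>x. if x \<in> {a..b} then indicator A x * f x else 0)"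
    using A(2) by (auto simp: fun_eq_iff indicator_def)
  ultimately have "((\<lambda>x. indicator A x * f x) has_integral integral\<^sup>L lborel (\<lambda>x. indicator A x * f x)) {a..b}"
    using has_integral_restrict_UNIV by metis
  then show ?thesis by (rule that)
qed

theorem corollary1p6:
  fixes T :: "'a::complex_hilbert_space \<Rightarrow> 'a"
    and \<gamma> :: "real \<Rightarrow> complex"
    and r \<epsilon> :: "real \<Rightarrow> real"
    and dm dp \<nu> :: real
  assumes "ritt_operator T"
    and "v_type_curve dm dp \<gamma>"
    and "\<And>\<theta>. r \<theta> = cmod (\<gamma> \<theta>)"
    and "\<nu> \<ge> r dp - 1"
    and "\<And>x. x \<in> {0<..\<nu>} \<Longrightarrow> \<epsilon> x > 0"
    and "continuous_on {0<..\<nu>} \<epsilon>"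
    and "mono_on {0<..\<nu>} \<epsilon>"
    and "(\<epsilon> \<longlongrightarrow> 0) (at_right 0)"
    and "\<And>z. z \<in> v_type_domain dm dp \<gamma> \<Longrightarrow> z \<noteq> 1 \<Longrightarrow>
           onorm (resolvent T z) \<le> (1 + \<epsilon> (cmod z - 1)) / (cmod z - 1)"
    and "(\<integral>\<^sup>+\<theta>\<in>{-dm..dp}. ennreal (\<epsilon> (r \<theta> - 1) / (\<bar>\<theta>\<bar>\<^sup>2 * (r \<theta> - 1))) \<partial>lborel) < \<infinity>"
  shows "similar_to_contraction T"
proof -
  obtain C where "resolvent_family T (inv_one_minus T) C"
    using ritt_resolvent_family[OF assms(1)] .
  then interpret resolvent_family T "inv_one_minus T" C .
  from assms(2) obtain r' where d: "0 < dm" "dm < pi" "0 < dp" "dp < pi"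
    and r': "continuous_on {-dm..dp} r'" "\<And>\<theta>. \<theta> \<in> {-dm..dp} \<Longrightarrow> r' \<theta> \<ge> 1"
    and \<gamma>: "\<And>\<theta>. \<theta> \<in> {-dm..dp} \<Longrightarrow> \<gamma> \<theta> = complex_of_real (r' \<theta>) * cis (-\<theta>)"
    and inc: "strict_mono_on {0..dp} r'" and dec: "strict_antimono_on {-dm..0} r'"
    and r0: "r' 0 = 1" and ends: "r' (-dm) = r' dp" "r' dp > 1"
    and fin: "(\<integral>\<^sup>+\<theta>\<in>{-dm..dp}. ennreal (1 / (r' \<theta> - 1)) \<partial>lborel) < \<infinity>"
    unfolding v_type_curve_def by auto
  have r: "r \<theta> = r' \<theta>" if "\<theta> \<in> {-dm..dp}" for \<theta>
    using \<gamma>[OF that] r'(2)[OF that] by (simp add: assms(3) norm_mult)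
  define A where "A = {-dm..dp} - {0}"
  have r_range: "1 < r \<theta>" "r \<theta> \<le> r dp" if "\<theta> \<in> A" for \<theta>
  proof -
    have th: "\<theta> \<in> {-dm..dp}" "\<theta> \<noteq> 0" using that by (auto simp: A_def)
    have "1 < r' \<theta> \<and> r' \<theta> \<le> r' dp"
    proof (cases "0 < \<theta>")
      case True
      have "r' 0 < r' \<theta>" using True th d by (intro strict_mono_onD[OF inc]) auto
      moreover have "r' \<theta> \<le> r' dp"
        using True th strict_mono_onD[OF inc, of \<theta> dp] by (cases "\<theta> = dp") auto
      ultimately show ?thesis by (simp add: r0)
    next
      case False
      have "r' 0 < r' \<theta>" using False th d by (intro monotone_onD[OF dec]) auto
      moreover have "r' \<theta> \<le> r' (-dm)"
        using False th monotone_onD[OF dec, of "-dm" \<theta>] by (cases "\<theta> = -dm") auto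
      ultimately show ?thesis by (simp add: r0 ends)
    qed
    then show "1 < r \<theta>" "r \<theta> \<le> r dp" using r[OF th(1)] r[of dp] d by auto
  qed
  have \<epsilon>_pos: "0 < \<epsilon> (r \<theta> - 1)" and s_dom: "r \<theta> - 1 \<in> {0<..\<nu>}" if "\<theta> \<in> A" for \<theta>
  proof -
    show "r \<theta> - 1 \<in> {0<..\<nu>}" using r_range[OF that] assms(4) by auto
    then show "0 < \<epsilon> (r \<theta> - 1)" by (rule assms(5))
  qed
  have contr: "continuous_on A r"
    using continuous_on_subset[OF r'(1), of A] r by (auto simp: A_def cong: continuous_on_cong_simp)
  have cont\<epsilon>: "continuous_on A (\<lambda>\<theta>. \<epsilon> (r \<theta> - 1))"
    by (rule continuous_on_compose2[OF assms(6)]) (use s_dom in \<open>auto intro!: continuous_intros contr\<close>)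
  have A: "A \<in> sets borel" "A \<subseteq> {-pi..pi}" using d by (auto simp: A_def)
  obtain I1 where I1: "((\<lambda>\<theta>. indicator A \<theta> * (1 / (r \<theta> - 1))) has_integral I1) {-pi..pi}"
  proof (rule has_integral_of_nn_integral_finite[OF A _ _ fin])
    show "continuous_on A (\<lambda>\<theta>. 1 / (r \<theta> - 1))"
      by (intro continuous_intros contr) (use r_range in force)
    show "0 \<le> 1 / (r \<theta> - 1)" if "\<theta> \<in> A" for \<theta> using r_range[OF that] by simp
  qed (use r in \<open>auto simp: A_def\<close>)
  obtain I2 where I2: "((\<lambda>\<theta>. indicator A \<theta> * (\<epsilon> (r \<theta> - 1) / (\<bar>\<theta>\<bar>\<^sup>2 * (r \<theta> - 1)))) has_integral I2) {-pi..pi}"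
  proof (rule has_integral_of_nn_integral_finite[OF A _ _ assms(10)])
    show "continuous_on A (\<lambda>\<theta>. \<epsilon> (r \<theta> - 1) / (\<bar>\<theta>\<bar>\<^sup>2 * (r \<theta> - 1)))"
      by (intro continuous_intros contr cont\<epsilon>) (use r_range in \<open>force simp: A_def\<close>)
    show "0 \<le> \<epsilon> (r \<theta> - 1) / (\<bar>\<theta>\<bar>\<^sup>2 * (r \<theta> - 1))" if "\<theta> \<in> A" for \<theta>
      using r_range[OF that] \<epsilon>_pos[OF that] by simp
  qed (auto simp: A_def)
  define S where "S = r dp - 1"
  \<comment> \<open>\<open>c\<close> covers the angles outside \<open>[-dm, dp]\<close>, where the Ritt bound is at most
    \<open>C \<pi> / \<bar>\<theta>\<bar>\<close>.\<close>
  define c where "c = C * pi / min dm dp"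
  define h where "h \<theta> = (2 + 4 * C) * (indicator A \<theta> * (1 / (r \<theta> - 1)))
      + C\<^sup>2 * pi\<^sup>2 * S\<^sup>2 * (indicator A \<theta> * (\<epsilon> (r \<theta> - 1) / (\<bar>\<theta>\<bar>\<^sup>2 * (r \<theta> - 1)))) + c" for \<theta>
  have c: "0 \<le> c" using C d by (simp add: c_def)
  have hA: "0 \<le> indicator A \<theta> * (1 / (r \<theta> - 1))"
    "0 \<le> indicator A \<theta> * (\<epsilon> (r \<theta> - 1) / (\<bar>\<theta>\<bar>\<^sup>2 * (r \<theta> - 1)))" for \<theta>
    using r_range[of \<theta>] \<epsilon>_pos[of \<theta>] by (auto simp: indicator_def)
  have h_nonneg: "0 \<le> h \<theta>" for \<theta>
    unfolding h_def using c C by (intro add_nonneg_nonneg mult_nonneg_nonneg[OF _ hA(1)] mult_nonneg_nonneg[OF _ hA(2)]) auto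
  have h_int: "(h has_integral (2 + 4 * C) * I1 + C\<^sup>2 * pi\<^sup>2 * S\<^sup>2 * I2 + measure lborel {-pi..pi} *\<^sub>R c) {-pi..pi}"
    unfolding h_def[abs_def] by (intro has_integral_add has_integral_mult_right I1 I2 has_integral_const_real)
  show ?thesis
  proof (rule similar_to_contraction_if_Re_bounded_below[OF h_int h_nonneg])
    fix t \<theta> :: real and x :: 'a
    assume t: "t \<in> {1/2..<1}" and th: "\<theta> \<in> {-pi..pi}" "\<theta> \<noteq> 0"
    let ?w = "of_real t * cis \<theta>"
    have w: "cmod ?w < 1" using t by (simp add: norm_mult)
    have \<kappa>1: "1 - t \<le> cmod (1 - ?w)" using t by (intro cmod_one_minus_ge) auto
    have \<kappa>2: "\<bar>\<theta>\<bar> / pi \<le> cmod (1 - ?w)"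
    proof -
      have "2 / pi * \<bar>\<theta>\<bar> \<le> cmod (1 - cis \<theta>)" using th by (intro cmod_one_minus_cis_ge) auto
      also have "\<dots> \<le> 2 * cmod (1 - ?w)" using t by (intro cmod_one_minus_cis_le) auto
      finally show ?thesis by simp
    qed
    have th0: "0 < \<bar>\<theta>\<bar> / pi" using th by simp
    show "- (h \<theta> * (norm x)\<^sup>2) \<le> inner (inv_one_minus T ?w x) x"
    proof (cases "\<theta> \<in> A")
      case False
      then have "min dm dp \<le> \<bar>\<theta>\<bar>" using th by (auto simp: A_def)
      then have "C / (\<bar>\<theta>\<bar> / pi) \<le> c"
        using C d unfolding c_def by (simp add: divide_left_mono)
      then have "C / (\<bar>\<theta>\<bar> / pi) * (norm x)\<^sup>2 \<le> c * (norm x)\<^sup>2" by (rule mult_right_mono) simp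
      moreover have "h \<theta> = c" using False by (simp add: h_def)
      ultimately have "C / (\<bar>\<theta>\<bar> / pi) * (norm x)\<^sup>2 \<le> h \<theta> * (norm x)\<^sup>2" by (simp only:)
      then show ?thesis using inner_Q_ge(1)[OF w th0 \<kappa>2, of x] by linarith
    next
      case True
      define s where "s = r \<theta> - 1"
      have s: "0 < s" "s \<le> S" using r_range[OF True] by (auto simp: s_def S_def)
      let ?e = "\<epsilon> s"
      have e: "0 < ?e" using \<epsilon>_pos[OF True] by (simp add: s_def)
      have h\<theta>: "h \<theta> = (2 + 4 * C) / s + C\<^sup>2 * pi\<^sup>2 * S\<^sup>2 * (?e / (\<bar>\<theta>\<bar>\<^sup>2 * s)) + c"
        using True by (simp add: h_def s_def)
      show ?thesis
        \<comment> \<open>If \<open>1 / t\<close> is at most halfway between \<open>1\<close> and \<open>r \<theta>\<close>, the point of the curve on the same ray is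
          used; otherwise \<open>1 - t \<ge> s / 4\<close> and the Ritt bound suffices.\<close>
      proof (cases "1 / t - 1 \<le> s / 2")
        case True': True
        let ?z = "of_real (1 + s) * cis (- \<theta>)"
        have cz: "cmod ?z = 1 + s" using s by (simp add: norm_mult del: of_real_add)
        have "?z \<in> v_type_domain dm dp \<gamma>"
          unfolding v_type_domain_def mem_Collect_eq
          by (rule exI[of _ "r \<theta>"], rule exI[of _ \<theta>])
             (use True r_range[OF True] in \<open>simp add: A_def s_def assms(3)[symmetric]\<close>)
        moreover have "?z \<noteq> 1" using cz s by (metis add_cancel_left_right less_irrefl norm_one)
        ultimately have on: "onorm (resolvent T ?z) \<le> (1 + ?e) / s" using assms(9)[of ?z] cz by simp
        have "?z \<notin> spectrum T"
          using assms(1) cz s by (auto simp: ritt_operator_def)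
        note R = resolvent_inverse[OF this]
        have res: "norm v \<le> (1 + ?e) / s * norm (?z *\<^sub>C v - T v)" for v
        proof -
          have "norm (resolvent T ?z (?z *\<^sub>C v - T v)) \<le> onorm (resolvent T ?z) * norm (?z *\<^sub>C v - T v)"
            by (rule onorm[OF bounded_clinearD(1)[OF R(1)]])
          also have "\<dots> \<le> (1 + ?e) / s * norm (?z *\<^sub>C v - T v)" by (intro mult_right_mono on) auto
          finally show ?thesis unfolding R(2) .
        qed
        have "- (2 / s * (norm x)\<^sup>2 + ?e * s * (norm (inv_one_minus T ?w x))\<^sup>2) \<le> inner (inv_one_minus T ?w x) x"
          by (rule inner_Q_ge_near_contractive_point[OF _ _ True' _ res]) (use t e in auto)
        moreover have "?e * s * (norm (inv_one_minus T ?w x))\<^sup>2 \<le> C\<^sup>2 * pi\<^sup>2 * S\<^sup>2 * (?e / (\<bar>\<theta>\<bar>\<^sup>2 * s)) * (norm x)\<^sup>2"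
        proof -
          have "?e * s * (norm (inv_one_minus T ?w x))\<^sup>2 \<le> ?e * s * (C / (\<bar>\<theta>\<bar> / pi) * norm x)\<^sup>2"
            using e s by (intro mult_left_mono power_mono inner_Q_ge(2)[OF w th0 \<kappa>2]) auto
          also have "\<dots> = s\<^sup>2 * (C\<^sup>2 * pi\<^sup>2 * (?e / (\<bar>\<theta>\<bar>\<^sup>2 * s)) * (norm x)\<^sup>2)"
            using s th by (simp add: power_mult_distrib power_divide) (simp add: power2_eq_square field_simps)
          also have "\<dots> \<le> S\<^sup>2 * (C\<^sup>2 * pi\<^sup>2 * (?e / (\<bar>\<theta>\<bar>\<^sup>2 * s)) * (norm x)\<^sup>2)"
            using s e by (intro mult_right_mono power_mono mult_nonneg_nonneg) auto
          finally show ?thesis by (simp add: mult_ac)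
        qed
        moreover have "2 / s * (norm x)\<^sup>2 + C\<^sup>2 * pi\<^sup>2 * S\<^sup>2 * (?e / (\<bar>\<theta>\<bar>\<^sup>2 * s)) * (norm x)\<^sup>2 \<le> h \<theta> * (norm x)\<^sup>2"
        proof -
          have "2 / s \<le> (2 + 4 * C) / s" using C s by (intro divide_right_mono) auto
          then show ?thesis unfolding h\<theta> distrib_right[symmetric] using c by (intro mult_right_mono) auto
        qed
        ultimately show ?thesis by linarith
      next
        case False
        have "s / 4 \<le> 1 - t"
        proof -
          have "s / 2 * t \<le> 1 - t" using False t by (simp add: field_simps)
          moreover have "s / 2 * (1/2) \<le> s / 2 * t" using s t by (intro mult_left_mono) auto
          ultimately show ?thesis by simp
        qed
        then have "- (C / (s / 4) * (norm x)\<^sup>2) \<le> inner (inv_one_minus T ?w x) x"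
          using s \<kappa>1 by (intro inner_Q_ge(1)[OF w]) auto
        moreover have "C / (s / 4) * (norm x)\<^sup>2 \<le> h \<theta> * (norm x)\<^sup>2"
        proof -
          have "C / (s / 4) \<le> (2 + 4 * C) / s" using s by (simp add: field_simps)
          moreover have "0 \<le> C\<^sup>2 * pi\<^sup>2 * S\<^sup>2 * (?e / (\<bar>\<theta>\<bar>\<^sup>2 * s))" using e s by simp
          ultimately show ?thesis unfolding h\<theta> using c by (intro mult_right_mono) auto
        qed
        ultimately show ?thesis by linarith
      qed
    qed
  qed
qed

end
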